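(* Let $\mathcal{D}\subseteq\mathbb{R}^n$ be a bounded closed set and let $f:\mathcal{D}\to\mathbb{R}^m$ be differentiable with continuous derivative on $\mathcal{D}$. Suppose that $f$ satisfies the tangential cone condition on $\mathcal{D}$ with constant $\eta\in(0,1)$, i.e. $\|f(x_1)-f(x_2)-\nabla f(x_1)(x_1-x_2)\|_2\le \eta\|f(x_1)-f(x_2)\|_2$ for all $x_1,x_2\in\mathcal{D}$. Let $\varphi:\mathbb{R}^n\to\mathbb{R}$ be proper, convex, lower semicontinuous, $\gamma$-strongly convex ($\gamma>0$) and $M$-smooth with respect to $\|\cdot\|_2$. Let $\hat{x}$ be a solution of $\min_{x\in\mathcal{D}}\varphi(x)$ subject to $f(x)=0$, and assume that $\nabla f(\hat{x})$ has full column rank. Put $$\underline{\sigma}=\inf_{x\in\mathcal{D}}\sigma_{\min}(\nabla f(x)),\qquad \overline{\sigma}=\sup_{x\in\mathcal{D}}\sigma_{\max}(\nabla f(x)),$$ $$a=\underline{\sigma}^4>0,\qquad b=-\overline{\sigma}^4+\underline{\sigma}^2\overline{\sigma}^2\le 0,$$ and assume $a+b>0$, i.e. $\underline{\sigma}^4-\overline{\sigma}^4+\underline{\sigma}^2\overline{\sigma}^2>0$. Assume that $0<\eta<1$ if $b=0$, and that $0<\eta<\min\left\{1,\frac{a-b}{a+b}-2\frac{\sqrt{|ab|}}{a+b}\right\}$ if $b\ne 0$. Let $0<\delta\le\min\{2,Q\}$, where $$Q=2\left(\frac{\underline{\sigma}^4}{\overline{\sigma}^4}(1-\eta)-\frac{(\overline{\sigma}^2-\underline{\sigma}^2)(1+\eta)^2}{\overline{\sigma}^2(1-\eta)}\right).$$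 Then the sequences $\{x_k\}$ and $\{x_k^*\}$ generated by the stochastic column-block nonlinear Bregman (SCBNB) method with $\tau$ column blocks and parameters $\delta,\gamma$ (described in the context) satisfy, for every $k\ge 0$, $$\mathbf{E}\left[D_{\varphi}^{x_{k+1}^*}(x_{k+1},\hat{x})\right]\le(1-c)^{k+1}\,\mathbf{E}\left[D_{\varphi}^{x_0^*}(x_0,\hat{x})\right],$$ where $$c=\frac{1}{M}\left[\frac{2\gamma\underline{\sigma}^4(1-\eta)^2-2\gamma(\overline{\sigma}^2-\underline{\sigma}^2)(1+\eta)^2\overline{\sigma}^2}{2\tau(1+\eta)^2\overline{\sigma}^2\underline{\sigma}^2(1-\eta)}\,\delta-\frac{\gamma\overline{\sigma}^4(1-\eta)}{2\tau(1+\eta)^2\overline{\sigma}^2\underline{\sigma}^2(1-\eta)}\,\delta^2\right].$$ Further, if $x_0^*=x_0=0$, then for every $k\ge 0$ $$\mathbf{E}\left[\|x_k-\hat{x}\|_2^2\right]\le\frac{2}{\gamma}(1-c)^k\varphi(\hat{x}).$$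
   Context: Notation. $\|\cdot\|_2$ is the Euclidean norm; $\nabla f(x)\in\mathbb{R}^{m\times n}$ is the Jacobian matrix of $f$ at $x$. For a matrix $A$, $\sigma_{\min}(A)$ and $\sigma_{\max}(A)$ denote its smallest and largest nonzero singular values. For an index set $J\subseteq\{1,\dots,n\}$, $\nabla f_{:,J}(x)$ is the submatrix of $\nabla f(x)$ formed by the columns with indices in $J$, and $I_{:,J}$ is the submatrix of the $n\times n$ identity matrix formed by the columns with indices in $J$. Convex analysis. The subdifferential of $\varphi$ at $x$ is $\partial\varphi(x)=\{x^*\in\mathbb{R}^n:\varphi(x)+\langle x^*,y-x\rangle\le\varphi(y)\text{ for all }y\in\mathrm{dom}\,\varphi\}$. For $x^*\in\partial\varphi(x)$ the Bregman distance is $D_\varphi^{x^*}(x,y)=\varphi(y)-\varphi(x)-\langle x^*,y-x\rangle$. $\varphi^*$ denotes the Fenchel conjugate of $\varphi$; it is differentiable since $\varphi$ is strongly convex. $\varphi$ is $M$-smooth with respect to $\|\cdot\|_2$ if it is differentiable and $\varphi(y)\le\varphi(x)+\langle\nabla\varphi(x),y-x\rangle+\frac{M}{2}\|x-y\|_2^2$ for all $x,y\in\mathbb{R}^n$. SCBNB method (stochastic column-block nonlinear Bregman method). Let $J_1,\dots,J_\tau$ be a partition of the column index set $\{1,\dots,n\}$ into $\tau$ nonempty blocks. Choose $x_0^*\in\mathbb{R}^n$ and set $x_0=\nabla\varphi^*(x_0^* )$. For $k=0,1,2,\dots$: pick $\xi_k\in\{J_1,\dots,J_\tau\}$ uniformly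 at random (independently of the previous choices) and set $$x_{k+1}^*=x_k^*-\delta\,\frac{\gamma\|\nabla f_{:,\xi_k}(x_k)^Tf(x_k)\|_2^2}{\|\nabla f_{:,\xi_k}(x_k)\nabla f_{:,\xi_k}(x_k)^Tf(x_k)\|_2^2}\,I_{:,\xi_k}\nabla f_{:,\xi_k}(x_k)^Tf(x_k),\qquad x_{k+1}=\nabla\varphi^*(x_{k+1}^* ),$$ with the convention that $x_{k+1}^*=x_k^*$ if $\nabla f_{:,\xi_k}(x_k)^Tf(x_k)=0$. Here $\gamma$ is the strong convexity constant of $\varphi$. The iterates $x_k$ are understood to lie in $\mathcal{D}$, the domain of $f$, so that the method is well defined. $\mathbf{E}$ denotes expectation over the random choices of the blocks.
   Formalization: Added since the claim fails otherwise: D is connected or the Jacobian of f has full column rank at every point of D (not only at the solution); and, for the final norm bound only, φ(0) ≥ 0. *)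

theory Defs
  imports "HOL-Probability.Probability"
begin

definition grad :: "(real ^ 'n \<Rightarrow> real) \<Rightarrow> real ^ 'n \<Rightarrow> real ^ 'n" where
  "grad \<phi> x = (THE g. GDERIV \<phi> x :> g)"

definition lower_semicont :: "('a::topological_space \<Rightarrow> real) \<Rightarrow> bool" where
  "lower_semicont \<phi> \<longleftrightarrow> (\<forall>r. closed {x. \<phi> x \<le> r})"

definition strongly_convex :: "real \<Rightarrow> (real ^ 'n \<Rightarrow> real) \<Rightarrow> bool" where
  "strongly_convex \<gamma> \<phi> \<longleftrightarrow>
     (\<forall>x y t. 0 \<le> t \<and> t \<le> 1 \<longrightarrow>
        \<phi> ((1 - t) *\<^sub>R x + t *\<^sub>R y)
          \<le> (1 - t) * \<phi> x + t * \<phi> y - \<gamma> / 2 * t * (1 - t) * (norm (x - y))\<^sup>2)"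

definition smooth :: "real \<Rightarrow> (real ^ 'n \<Rightarrow> real) \<Rightarrow> bool" where
  "smooth M \<phi> \<longleftrightarrow>
     (\<forall>x. \<phi> differentiable (at x)) \<and>
     (\<forall>x y. \<phi> y \<le> \<phi> x + grad \<phi> x \<bullet> (y - x) + M / 2 * (norm (x - y))\<^sup>2)"

text \<open>The supremum is taken in the reals, so it is the Fenchel conjugate only where the
  set is bounded above; for a strongly convex \<open>\<phi>\<close> this is the case at every point.\<close>

definition fenchel_conj :: "(real ^ 'n \<Rightarrow> real) \<Rightarrow> real ^ 'n \<Rightarrow> real" where
  "fenchel_conj \<phi> xs = (SUP x. xs \<bullet> x - \<phi> x)"

text \<open>A Bregman distance when \<open>xs\<close> is a subgradient of \<open>\<phi>\<close> at \<open>x\<close>, as is the case for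
  \<open>x = grad (fenchel_conj \<phi>) xs\<close> if \<open>\<phi>\<close> is strongly convex.\<close>

definition bregman :: "(real ^ 'n \<Rightarrow> real) \<Rightarrow> real ^ 'n \<Rightarrow> real ^ 'n \<Rightarrow> real ^ 'n \<Rightarrow> real" where
  "bregman \<phi> xs x y = \<phi> y - \<phi> x - xs \<bullet> (y - x)"

definition nonzero_singular_values :: "real ^ 'n ^ 'm \<Rightarrow> real set" where
  "nonzero_singular_values A =
     {s. 0 < s \<and> (\<exists>v. v \<noteq> 0 \<and> (transpose A ** A) *v v = s\<^sup>2 *\<^sub>R v)}"

text \<open>The set above is finite, and empty only for \<open>A = 0\<close>, where \<open>Min\<close> and \<open>Max\<close> are
  unspecified.\<close>

definition sigma_min :: "real ^ 'n ^ 'm \<Rightarrow> real" where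
  "sigma_min A = Min (nonzero_singular_values A)"

definition sigma_max :: "real ^ 'n ^ 'm \<Rightarrow> real" where
  "sigma_max A = Max (nonzero_singular_values A)"

definition tangential_cone ::
  "(real ^ 'n) set \<Rightarrow> (real ^ 'n \<Rightarrow> real ^ 'm) \<Rightarrow> (real ^ 'n \<Rightarrow> real ^ 'n ^ 'm) \<Rightarrow> real \<Rightarrow> bool" where
  "tangential_cone D f Jf \<eta> \<longleftrightarrow>
     (\<forall>x1\<in>D. \<forall>x2\<in>D. norm (f x1 - f x2 - Jf x1 *v (x1 - x2)) \<le> \<eta> * norm (f x1 - f x2))"

text \<open>The submatrix with column set \<open>S\<close> is represented by the matrix of the original shape
  whose columns outside \<open>S\<close> are zero. Vectors indexed by \<open>S\<close> then become vectors in the full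
  space that vanish outside \<open>S\<close>; norms and products are the same as for the submatrices.\<close>

definition column_block :: "'n set \<Rightarrow> real ^ 'n ^ 'm \<Rightarrow> real ^ 'n ^ 'm" where
  "column_block S A = (\<chi> i j. if j \<in> S then A $ i $ j else 0)"

definition scbnb_step ::
  "(real ^ 'n \<Rightarrow> real ^ 'm) \<Rightarrow> (real ^ 'n \<Rightarrow> real ^ 'n ^ 'm) \<Rightarrow> (real ^ 'n \<Rightarrow> real) \<Rightarrow> real \<Rightarrow> real
   \<Rightarrow> 'n set \<Rightarrow> real ^ 'n \<Rightarrow> real ^ 'n" where
  "scbnb_step f Jf \<phi> \<gamma> \<delta> S xs =
     (let x = grad (fenchel_conj \<phi>) xs;
          A = column_block S (Jf x);
          g = transpose A *v f x
      in if g = 0 then xs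
         else xs - (\<delta> * (\<gamma> * (norm g)\<^sup>2 / (norm (A *v g))\<^sup>2)) *\<^sub>R (column_block S (mat 1) *v g))"

text \<open>The dual iterates for the block sequence \<open>B\<close>; the primal iterates are their images
  under \<open>grad (fenchel_conj \<phi>)\<close>.\<close>

primrec scbnb_dual ::
  "(real ^ 'n \<Rightarrow> real ^ 'm) \<Rightarrow> (real ^ 'n \<Rightarrow> real ^ 'n ^ 'm) \<Rightarrow> (real ^ 'n \<Rightarrow> real) \<Rightarrow> real \<Rightarrow> real
   \<Rightarrow> real ^ 'n \<Rightarrow> (nat \<Rightarrow> 'n set) \<Rightarrow> nat \<Rightarrow> real ^ 'n" where
  "scbnb_dual f Jf \<phi> \<gamma> \<delta> xs0 B 0 = xs0"
| "scbnb_dual f Jf \<phi> \<gamma> \<delta> xs0 B (Suc k) =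
     scbnb_step f Jf \<phi> \<gamma> \<delta> (B k) (scbnb_dual f Jf \<phi> \<gamma> \<delta> xs0 B k)"

end

theory Submission
  imports Defs
begin

text \<open>
  For a fixed state the Bregman distance after a step with block \<open>S\<close> is bounded by the current one,
  plus a term linear in the step and a quadratic term controlled by the \<open>1/\<gamma>\<close>-smoothness of the
  conjugate. Summed over the partition, the linear terms give the inner product of the full gradient
  with the error up to the variation of the step sizes, and the tangential cone condition bounds
  this product below by a multiple of the squared residual. The squared residual in turn dominates
  the Bregman distance, by the lower singular value bound and the smoothness of \<open>\<phi>\<close>.

  The block sequences of length \<open>k\<close> are equally likely, so expectations are averages over them.
  Each sequence has positive probability, hence its iterate lies in \<open>D\<close>.
\<close>

text \<open>\<open>sigma_min\<close> ignores zero singular values, so \<open>\<sigma>l > 0\<close>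
  alone gives no lower bound on \<open>norm (Jf x *v v)\<close> where \<open>Jf x\<close> has a
  kernel. When full rank is assumed only at \<open>xhat\<close>, connectedness carries it to all of
  \<open>D\<close>: the points with gain at least \<open>\<sigma>l\<close> and the points with a
  kernel form two disjoint closed sets covering \<open>D\<close>. The condition
  \<open>a + b > 0\<close> enters by excluding \<open>\<sigma>l = 0\<close>.

  The constants come from one coefficient, \<open>descent_rate\<close>, which multiplies the squared
  residual in the summed decrease. \<open>Q\<close> is its zero as a function of
  \<open>\<delta>\<close>. In \<open>c\<close> it is multiplied by the factors that turn the
  residual into the Bregman distance: \<open>\<sigma>l\<^sup>2 / (1 + \<eta>)\<^sup>2\<close> from
  the cone condition, \<open>1 / M\<close> from smoothness, and \<open>1 / \<tau>\<close> from
  averaging over the blocks.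

  The last bound is in terms of \<open>\<phi> xhat\<close>, whereas the Bregman distance from a zero
  start is \<open>\<phi> xhat - \<phi> 0\<close>; the sign condition on \<open>\<phi> 0\<close>
  bridges the two.\<close>

subsection \<open>Extremal singular values\<close>

lemma linear_coeff_zero:
  fixes p q :: real
  assumes "\<And>t. 0 \<le> q * t\<^sup>2 + p * t"
  shows "p = 0"
proof (rule ccontr)
  assume p: "p \<noteq> 0"
  \<comment> \<open>Near 0 the linear term dominates; any positive \<open>r\<close> above
    \<open>q\<close> puts \<open>- p / r\<close> close enough to 0 on the side where that term is
    negative.\<close>
  define r where "r = \<bar>q\<bar> + 1"
  have r: "r > 0" "q < r" by (auto simp: r_def)
  have "q * (- (p / r))\<^sup>2 + p * (- (p / r)) = p\<^sup>2 * (q - r) / r\<^sup>2"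
    using r by (simp add: field_simps power2_eq_square)
  also have "\<dots> < 0"
    using r p by (intro divide_neg_pos mult_pos_neg) auto
  finally show False using assms[of "- (p / r)"] by linarith
qed

lemma gram_inner:
  fixes A :: "real ^ 'n ^ 'm"
  shows "((transpose A ** A) *v v) \<bullet> w = (A *v v) \<bullet> (A *v w)"
  by (simp add: matrix_vector_mul_assoc[symmetric] dot_lmul_matrix)

text \<open>The nonnegative quadratic form in \<open>ext\<close> vanishes at \<open>v\<close>, so
  its first variation there is zero in every direction \<open>w\<close>. The sign of
  \<open>s\<close> lets one argument serve both minimisers and maximisers of the Rayleigh
  quotient.\<close>

lemma rayleigh_extremal_eigenvector:
  fixes A :: "real ^ 'n ^ 'm"
  assumes v: "(norm (A *v v))\<^sup>2 = \<mu> * (norm v)\<^sup>2"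
    and ext: "\<And>w. 0 \<le> s * ((norm (A *v w))\<^sup>2 - \<mu> * (norm w)\<^sup>2)" and "s \<noteq> 0"
  shows "(transpose A ** A) *v v = \<mu> *\<^sub>R v"
proof -
  have "((transpose A ** A) *v v - \<mu> *\<^sub>R v) \<bullet> w = 0" for w
  proof -
    let ?q = "s * ((norm (A *v w))\<^sup>2 - \<mu> * (norm w)\<^sup>2)"
    let ?p = "2 * s * ((A *v v) \<bullet> (A *v w) - \<mu> * (v \<bullet> w))"
    have "?p = 0"
    proof (rule linear_coeff_zero)
      fix t :: real
      have "s * ((norm (A *v (v + t *\<^sub>R w)))\<^sup>2 - \<mu> * (norm (v + t *\<^sub>R w))\<^sup>2)
          = s * ((norm (A *v v))\<^sup>2 - \<mu> * (norm v)\<^sup>2) + (?q * t\<^sup>2 + ?p * t)"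
        unfolding matrix_vector_right_distrib matrix_vector_mult_scaleR power2_norm_eq_inner
        by (simp add: inner_add_left inner_add_right inner_commute algebra_simps power2_eq_square)
      then show "0 \<le> ?q * t\<^sup>2 + ?p * t"
        using ext[of "v + t *\<^sub>R w"] v by simp
    qed
    then show ?thesis using \<open>s \<noteq> 0\<close> by (simp add: inner_diff_left gram_inner)
  qed
  then show ?thesis by (metis inner_eq_zero_iff right_minus_eq)
qed

text \<open>The Gram matrix is symmetric, so eigenvectors chosen for different \<open>s\<close> are
  orthogonal, hence independent. Finiteness is what gives \<open>Min\<close> and \<open>Max\<close>
  their meaning.\<close>

lemma finite_nonzero_singular_values:
  fixes A :: "real ^ 'n ^ 'm"
  shows "finite (nonzero_singular_values A)"
proof -
  let ?S = "nonzero_singular_values A"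
  define e where "e s = (SOME v. v \<noteq> 0 \<and> (transpose A ** A) *v v = s\<^sup>2 *\<^sub>R v)" for s
  have e: "e s \<noteq> 0" "(transpose A ** A) *v e s = s\<^sup>2 *\<^sub>R e s" if "s \<in> ?S" for s
    using someI_ex[of "\<lambda>v. v \<noteq> 0 \<and> (transpose A ** A) *v v = s\<^sup>2 *\<^sub>R v"] that
    by (auto simp: nonzero_singular_values_def e_def)
  have orth: "e s \<bullet> e t = 0" if "s \<in> ?S" "t \<in> ?S" "s \<noteq> t" for s t
  proof -
    have "s\<^sup>2 * (e s \<bullet> e t) = t\<^sup>2 * (e s \<bullet> e t)"
      using gram_inner[of A "e s" "e t"] gram_inner[of A "e t" "e s"] e that
      by (simp add: inner_commute)
    moreover have "s\<^sup>2 \<noteq> t\<^sup>2"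
      using that by (auto simp: nonzero_singular_values_def power2_eq_iff)
    ultimately show ?thesis by auto
  qed
  have "pairwise orthogonal (e ` ?S)"
    using orth by (auto simp: pairwise_def orthogonal_def)
  then have "independent (e ` ?S)"
    using e by (intro pairwise_orthogonal_independent) auto
  then have "finite (e ` ?S)"
    by (rule finiteI_independent)
  moreover have "inj_on e ?S"
    using orth e by (auto simp: inj_on_def) (metis inner_eq_zero_iff)
  ultimately show ?thesis by (rule finite_imageD)
qed

lemma unit_vector_exists: "\<exists>u :: real ^ 'n. norm u = 1"
  by (rule exI[of _ "axis undefined 1"]) simp

lemma gain_homogeneous:
  fixes A :: "real ^ 'n ^ 'm"
  assumes "v \<noteq> 0"
  shows "norm (A *v v) = norm v * norm (A *v (inverse (norm v) *\<^sub>R v))"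
  using assms by (simp add: matrix_vector_mult_scaleR)

text \<open>Used with \<open>s = 1\<close> at a minimiser and \<open>s = -1\<close> at a maximiser
  of the gain on the unit sphere. Homogeneity extends the extremality from the sphere to all
  \<open>w\<close>.\<close>

lemma singular_value_of_gain:
  fixes A :: "real ^ 'n ^ 'm"
  assumes u: "norm u = 1" "A *v u \<noteq> 0" and "s \<noteq> 0"
    and ext: "\<And>w. norm w = 1 \<Longrightarrow> 0 \<le> s * (norm (A *v w) - norm (A *v u))"
  shows "norm (A *v u) \<in> nonzero_singular_values A"
proof -
  have "(transpose A ** A) *v u = (norm (A *v u))\<^sup>2 *\<^sub>R u"
  proof (rule rayleigh_extremal_eigenvector[OF _ _ \<open>s \<noteq> 0\<close>])
    fix w :: "real ^ 'n"
    show "0 \<le> s * ((norm (A *v w))\<^sup>2 - (norm (A *v u))\<^sup>2 * (norm w)\<^sup>2)"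
    proof (cases "w = 0")
      case False
      let ?w = "inverse (norm w) *\<^sub>R w"
      have "0 \<le> s * (norm (A *v ?w) - norm (A *v u))" using False by (intro ext) simp
      then have "0 \<le> (norm w)\<^sup>2 * (norm (A *v ?w) + norm (A *v u))
          * (s * (norm (A *v ?w) - norm (A *v u)))"
        by (intro mult_nonneg_nonneg[where a = "_ * _"]) auto
      also have "\<dots> = s * ((norm w * norm (A *v ?w))\<^sup>2 - (norm (A *v u))\<^sup>2 * (norm w)\<^sup>2)"
        by (simp only: power2_eq_square) algebra
      finally show ?thesis by (subst gain_homogeneous[OF False])
    qed simp
  qed (simp add: u)
  then show ?thesis using u by (auto simp: nonzero_singular_values_def intro!: exI[of _ u])
qed

text \<open>The largest gain on the unit sphere is attained, and it is positive because
  \<open>A \<noteq> 0\<close>, so it is one of the nonzero singular values.\<close>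

lemma norm_mult_le_sigma_max:
  fixes A :: "real ^ 'n ^ 'm"
  assumes "A \<noteq> 0"
  shows "norm (A *v v) \<le> sigma_max A * norm v" "sigma_max A \<in> nonzero_singular_values A"
proof -
  have "continuous_on (sphere 0 1) (\<lambda>v. norm (A *v v))" by (intro continuous_intros)
  then obtain u where u: "norm u = 1" "\<And>w. norm w = 1 \<Longrightarrow> norm (A *v w) \<le> norm (A *v u)"
    using continuous_attains_sup[of "sphere (0 :: real ^ 'n) 1" "\<lambda>v. norm (A *v v)"]
      unit_vector_exists[where 'n = 'n] by auto
  have le: "norm (A *v w) \<le> norm (A *v u) * norm w" for w
    by (cases "w = 0")
      (use gain_homogeneous[of w A] u(2)[of "inverse (norm w) *\<^sub>R w"]
        in \<open>auto simp: mult.commute intro!: mult_left_mono\<close>)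
  have "A *v u \<noteq> 0"
  proof
    assume "A *v u = 0"
    then have "A *v w = 0 *v w" for w using le[of w] by simp
    then show False using assms by (metis matrix_eq)
  qed
  then have S: "norm (A *v u) \<in> nonzero_singular_values A"
    using u by (intro singular_value_of_gain[where s = "-1"]) auto
  then have "norm (A *v u) \<le> sigma_max A"
    unfolding sigma_max_def by (intro Max_ge finite_nonzero_singular_values)
  then have "norm (A *v u) * norm v \<le> sigma_max A * norm v" by (intro mult_right_mono) auto
  with le[of v] show "norm (A *v v) \<le> sigma_max A * norm v" by linarith
  show "sigma_max A \<in> nonzero_singular_values A"
    unfolding sigma_max_def using S by (intro Max_in finite_nonzero_singular_values) auto
qed

lemma sigma_min_in:
  fixes A :: "real ^ 'n ^ 'm"
  assumes "A \<noteq> 0"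
  shows "sigma_min A \<in> nonzero_singular_values A"
  unfolding sigma_min_def using norm_mult_le_sigma_max(2)[OF assms]
  by (intro Min_in finite_nonzero_singular_values) auto

lemma sigma_min_pos:
  fixes A :: "real ^ 'n ^ 'm"
  shows "A \<noteq> 0 \<Longrightarrow> 0 < sigma_min A"
  using sigma_min_in by (auto simp: nonzero_singular_values_def)

lemma sigma_min_le_sigma_max:
  fixes A :: "real ^ 'n ^ 'm"
  shows "A \<noteq> 0 \<Longrightarrow> sigma_min A \<le> sigma_max A"
  unfolding sigma_max_def
  by (intro Max_ge finite_nonzero_singular_values sigma_min_in)

text \<open>Injectivity makes the smallest gain on the unit sphere positive; only then is it a
  nonzero singular value and so at least \<open>sigma_min A\<close>.\<close>

lemma sigma_min_mult_le_norm:
  fixes A :: "real ^ 'n ^ 'm"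
  assumes inj: "inj ((*v) A)"
  shows "sigma_min A * norm v \<le> norm (A *v v)"
proof -
  have "continuous_on (sphere 0 1) (\<lambda>v. norm (A *v v))" by (intro continuous_intros)
  then obtain u where u: "norm u = 1" "\<And>w. norm w = 1 \<Longrightarrow> norm (A *v u) \<le> norm (A *v w)"
    using continuous_attains_inf[of "sphere (0 :: real ^ 'n) 1" "\<lambda>v. norm (A *v v)"]
      unit_vector_exists[where 'n = 'n] by auto
  have "u \<noteq> 0" using u by auto
  then have "A *v u \<noteq> 0" using inj by (metis injD matrix_vector_mult_0_right)
  then have "norm (A *v u) \<in> nonzero_singular_values A"
    using u by (intro singular_value_of_gain[where s = 1]) auto
  then have le: "sigma_min A \<le> norm (A *v u)"
    unfolding sigma_min_def by (intro Min_le finite_nonzero_singular_values)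
  show ?thesis
  proof (cases "v = 0")
    case False
    then have "norm (A *v u) \<le> norm (A *v (inverse (norm v) *\<^sub>R v))" by (intro u) simp
    with le have "norm v * sigma_min A \<le> norm v * norm (A *v (inverse (norm v) *\<^sub>R v))"
      by (intro mult_left_mono) auto
    also have "\<dots> = norm (A *v v)" by (rule gain_homogeneous[OF False, symmetric])
    finally show ?thesis by (simp add: mult.commute)
  qed simp
qed

lemma norm_matrix_vector_le:
  fixes A :: "real ^ 'n ^ 'm"
  shows "norm (A *v v) \<le> real CARD('m) * real CARD('n) * norm A * norm v"
proof -
  have "\<bar>A $ i $ j\<bar> \<le> norm A" for i j
    using component_le_norm_cart[of "A $ i" j] Finite_Cartesian_Product.norm_nth_le[of A i] by linarith
  then have "onorm ((*v) A) \<le> real CARD('m) * real CARD('n) * norm A"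
    by (rule onorm_le_matrix_component)
  then have "onorm ((*v) A) * norm v \<le> real CARD('m) * real CARD('n) * norm A * norm v"
    by (intro mult_right_mono) auto
  then show ?thesis
    using onorm[OF matrix_vector_mul_bounded_linear, of A v] by linarith
qed

text \<open>The dimension factor is crude, but the bound only has to keep \<open>sigma_max\<close>
  bounded over a compact family of matrices.\<close>

lemma sigma_max_le:
  fixes A :: "real ^ 'n ^ 'm"
  assumes "A \<noteq> 0"
  shows "sigma_max A \<le> real CARD('m) * real CARD('n) * norm A"
proof -
  obtain v where v: "v \<noteq> 0" "(transpose A ** A) *v v = (sigma_max A)\<^sup>2 *\<^sub>R v" "0 < sigma_max A"
    using norm_mult_le_sigma_max(2)[OF assms] by (auto simp: nonzero_singular_values_def)
  have "(norm (A *v v))\<^sup>2 = (sigma_max A * norm v)\<^sup>2"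
    using gram_inner[of A v v] v by (simp add: power2_norm_eq_inner power_mult_distrib)
  then have "norm (A *v v) = sigma_max A * norm v" using v by (simp add: power2_eq_iff_nonneg)
  then show ?thesis using norm_matrix_vector_le[of A v] v by simp
qed

section \<open>Full rank and uniform gain bounds over the domain\<close>

lemma inj_iff_rank:
  fixes A :: "real ^ 'n ^ 'm"
  shows "rank A = CARD('n) \<longleftrightarrow> (\<forall>v. A *v v = 0 \<longrightarrow> v = 0)"
proof -
  have "inj ((*v) A) \<longleftrightarrow> (\<forall>v. A *v v = 0 \<longrightarrow> v = 0)"
    by (rule linear_injective_0) (rule matrix_vector_mul_linear)
  then show ?thesis by (simp add: full_rank_injective)
qed

text \<open>Kernel vectors can be normalised, so this set is the projection of a compact set of
  pairs (point, unit kernel vector).\<close>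

lemma closed_singular_points:
  fixes J :: "real ^ 'k \<Rightarrow> real ^ 'n ^ 'm"
  assumes "compact D" "continuous_on D J"
  shows "closed {x \<in> D. \<exists>v. v \<noteq> 0 \<and> J x *v v = 0}"
proof -
  let ?K = "D \<times> sphere (0 :: real ^ 'n) 1"
  have "continuous_on ?K (\<lambda>z. J (fst z) *v snd z)"
    unfolding matrix_vector_mult_def
    by (intro continuous_intros continuous_on_compose2[OF assms(2)]) auto
  then have "closedin (top_of_set ?K) (?K \<inter> (\<lambda>z. J (fst z) *v snd z) -` {0})"
    by (intro continuous_closedin_preimage) auto
  then have "compact (?K \<inter> (\<lambda>z. J (fst z) *v snd z) -` {0})"
    by (rule closedin_compact[rotated]) (intro compact_Times assms(1) compact_sphere)
  then have "compact (fst ` (?K \<inter> (\<lambda>z. J (fst z) *v snd z) -` {0}))"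
    by (intro compact_continuous_image continuous_intros)
  moreover have "fst ` (?K \<inter> (\<lambda>z. J (fst z) *v snd z) -` {0})
      = {x \<in> D. \<exists>v. v \<noteq> 0 \<and> J x *v v = 0}" (is "?L = ?R")
  proof
    show "?L \<subseteq> ?R" by auto (metis norm_zero zero_neq_one)
    show "?R \<subseteq> ?L"
    proof
      fix x assume "x \<in> ?R"
      then obtain v where v: "x \<in> D" "v \<noteq> 0" "J x *v v = 0" by auto
      then have "(x, inverse (norm v) *\<^sub>R v) \<in> ?K \<inter> (\<lambda>z. J (fst z) *v snd z) -` {0}"
        by (simp add: matrix_vector_mult_scaleR)
      from imageI[OF this, of fst] show "x \<in> ?L" by simp
    qed
  qed
  ultimately show ?thesis by (simp add: compact_imp_closed)
qed

lemma closed_gain_ge: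
  fixes J :: "real ^ 'k \<Rightarrow> real ^ 'n ^ 'm"
  assumes "closed D" "continuous_on D J"
  shows "closed {x \<in> D. \<forall>v. s * norm v \<le> norm (J x *v v)}"
proof -
  have "closed {x \<in> D. s * norm v \<le> norm (J x *v v)}" for v
    unfolding matrix_vector_mult_def
    by (intro continuous_on_closed_Collect_le assms continuous_intros)
  then have "closed (\<Inter>v. {x \<in> D. s * norm v \<le> norm (J x *v v)})" by auto
  moreover have "(\<Inter>v. {x \<in> D. s * norm v \<le> norm (J x *v v)})
      = {x \<in> D. \<forall>v. s * norm v \<le> norm (J x *v v)}" by auto
  ultimately show ?thesis by simp
qed

text \<open>Rules out the points with \<open>J x = 0\<close>, where \<open>sigma_min\<close> is the unspecified \<open>Min {}\<close>.\<close>

lemma tangential_cone_deriv_nonzero: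
  fixes f :: "real ^ 'n \<Rightarrow> real ^ 'm"
  assumes tcc: "tangential_cone D f J \<eta>" and "\<eta> < 1"
    and y: "y \<in> D" "\<And>v. J y *v v = 0 \<Longrightarrow> v = 0" and x: "x \<in> D"
  shows "J x \<noteq> 0"
proof
  assume 0: "J x = 0"
  \<comment> \<open>A zero derivative at \<open>x\<close> makes the cone condition there force
    \<open>f x = f y\<close>; the condition at \<open>y\<close> then puts \<open>y - x\<close> in
    the trivial kernel of \<open>J y\<close>. Thus \<open>x = y\<close>, where the derivative is not
    zero.\<close>
  have "norm (f x - f y) \<le> \<eta> * norm (f x - f y)"
    using tcc x y(1) 0 unfolding tangential_cone_def by fastforce
  then have "(1 - \<eta>) * norm (f x - f y) \<le> 0" by (simp add: algebra_simps)
  then have eq: "f x = f y" using \<open>\<eta> < 1\<close> by (simp add: mult_le_0_iff)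
  have "norm (f y - f x - J y *v (y - x)) \<le> \<eta> * norm (f y - f x)"
    using tcc x y(1) unfolding tangential_cone_def by blast
  then have "y - x = 0" using eq by (intro y(2)) simp
  then have "J y = 0" using 0 by simp
  moreover obtain u :: "real ^ 'n" where "norm u = 1" using unit_vector_exists by blast
  ultimately show False using y(2)[of u] by auto
qed

text \<open>The infimum of positive numbers may be 0, hence the separate assumption on
  \<open>l\<close>. The alternative \<open>conn\<close> provides full rank at every point, which the
  lower gain bound requires.\<close>

lemma uniform_singular_value_bounds:
  fixes f :: "real ^ 'n \<Rightarrow> real ^ 'm"
  assumes D: "compact D" "continuous_on D J"
    and tcc: "tangential_cone D f J \<eta>" "\<eta> < 1"
    and y: "y \<in> D" "rank (J y) = CARD('n)"
    and conn: "connected D \<or> (\<forall>x\<in>D. rank (J x) = CARD('n))"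
    and l: "l = (INF x\<in>D. sigma_min (J x))" "l \<noteq> 0"
    and u: "u = (SUP x\<in>D. sigma_max (J x))"
  shows "0 < l" "l \<le> u"
    "\<And>x v. x \<in> D \<Longrightarrow> l * norm v \<le> norm (J x *v v)"
    "\<And>x v. x \<in> D \<Longrightarrow> norm (J x *v v) \<le> u * norm v"
proof -
  have nz: "J x \<noteq> 0" if "x \<in> D" for x
    using tangential_cone_deriv_nonzero[OF tcc y(1) _ that] y(2) by (auto simp: inj_iff_rank)
  have pos: "0 < sigma_min (J x)" if "x \<in> D" for x
    using that nz sigma_min_pos by blast
  have "0 \<le> l" unfolding l(1) using y(1) pos by (intro cINF_greatest) (auto intro: less_imp_le)
  with l(2) show l0: "0 < l" by simp
  \<comment> \<open>A real \<open>INF\<close> or \<open>SUP\<close> bounds its family only if the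
    family is bounded on that side; positivity settles the lower side, compactness of
    \<open>D\<close> the upper one.\<close>
  have bb: "bdd_below ((\<lambda>x. sigma_min (J x)) ` D)"
    using pos by (auto intro!: bdd_belowI[of _ 0] less_imp_le)
  have ll: "l \<le> sigma_min (J x)" if "x \<in> D" for x
    unfolding l(1) by (rule cINF_lower[OF bb that])
  have "bounded (J ` D)" using D by (simp add: compact_continuous_image compact_imp_bounded)
  then obtain B where B: "\<And>x. x \<in> D \<Longrightarrow> norm (J x) \<le> B" by (auto simp: bounded_iff)
  have "sigma_max (J x) \<le> real CARD('m) * real CARD('n) * B" if "x \<in> D" for x
    by (rule order_trans[OF sigma_max_le[OF nz[OF that]]])
      (intro mult_left_mono B that; simp)
  then have ba: "bdd_above ((\<lambda>x. sigma_max (J x)) ` D)" by (auto intro!: bdd_aboveI2)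
  have uu: "sigma_max (J x) \<le> u" if "x \<in> D" for x
    unfolding u by (rule cSUP_upper[OF that ba])
  show "l \<le> u"
    using ll[OF y(1)] uu[OF y(1)] sigma_min_le_sigma_max[OF nz[OF y(1)]] by linarith
  show "norm (J x *v v) \<le> u * norm v" if "x \<in> D" for x v
    using norm_mult_le_sigma_max(1)[OF nz[OF that], of v] mult_right_mono[OF uu[OF that], of "norm v"]
    by simp
  have gain: "l * norm v \<le> norm (J x *v v)" if "x \<in> D" "rank (J x) = CARD('n)" for x v
    using sigma_min_mult_le_norm[of "J x" v] mult_right_mono[OF ll[OF that(1)], of "norm v"] that(2)
    by (simp add: full_rank_injective)
  text \<open>On a connected \<open>D\<close> the gap between \<open>l > 0\<close> and zero makes the full-rank points closed.\<close>
  have "rank (J x) = CARD('n)" if x: "x \<in> D" for x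
    using conn
  proof
    assume conn: "connected D"
    let ?G = "{x \<in> D. \<forall>v. l * norm v \<le> norm (J x *v v)}"
    let ?S = "{x \<in> D. \<exists>v. v \<noteq> 0 \<and> J x *v v = 0}"
    have 1: "?G \<inter> ?S \<inter> D = {}"
    proof -
      have False if "\<forall>v. l * norm v \<le> norm (J x *v v)" "v \<noteq> 0" "J x *v v = 0" for x v
      proof -
        have "l * norm v \<le> 0" using that(1)[rule_format, of v] that(3) by simp
        then show False using l0 that(2) by (simp add: mult_le_0_iff)
      qed
      then show ?thesis by blast
    qed
    have 2: "D \<subseteq> ?G \<union> ?S"
    proof
      fix z assume z: "z \<in> D"
      show "z \<in> ?G \<union> ?S"
      proof (cases "rank (J z) = CARD('n)")
        case True then show ?thesis using gain[OF z] z by blast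
      next
        case False
        then have "\<exists>v. v \<noteq> 0 \<and> J z *v v = 0" unfolding inj_iff_rank by blast
        then show ?thesis using z by blast
      qed
    qed
    have 3: "closed ?G" by (intro closed_gain_ge D compact_imp_closed)
    have 4: "closed ?S" by (intro closed_singular_points D)
    have "?G \<inter> D = {} \<or> ?S \<inter> D = {}" by (rule connected_closedD[OF conn 1 2 3 4])
    moreover have "y \<in> ?G \<inter> D" using gain[OF y] y(1) by blast
    ultimately have "x \<notin> ?S" using x by blast
    then show ?thesis using x unfolding inj_iff_rank by blast
  qed (use x in blast)
  then show "l * norm v \<le> norm (J x *v v)" if "x \<in> D" for x v
    using gain that by blast
qed

subsection \<open>Strong convexity, conjugates and Bregman distances\<close>

lemma grad_eqI:
  assumes "GDERIV \<phi> x :> g"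
  shows "grad \<phi> x = g"
  unfolding grad_def
proof (rule the_equality)
  show "GDERIV \<phi> x :> g" by (rule assms)
next
  fix g' assume "GDERIV \<phi> x :> g'"
  then have "(\<lambda>h. h \<bullet> g') = (\<lambda>h. h \<bullet> g)"
    using assms unfolding gderiv_def by (rule has_derivative_unique)
  then have "(g' - g) \<bullet> g' = (g' - g) \<bullet> g" by (rule fun_cong)
  then have "(g' - g) \<bullet> (g' - g) = 0" by (simp only: inner_diff_right)
  then show "g' = g" by simp
qed

text \<open>Compare \<open>x\<close> with the point a fraction \<open>t\<close> of the way to
  \<open>z\<close>, divide by \<open>t\<close>, and let \<open>t\<close> tend to 0.\<close>

lemma strongly_convex_minimizer_growth:
  assumes sc: "strongly_convex \<gamma> \<phi>" and min: "\<And>z. \<phi> x - s \<bullet> x \<le> \<phi> z - s \<bullet> z"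
  shows "\<phi> x + s \<bullet> (z - x) + \<gamma> / 2 * (norm (x - z))\<^sup>2 \<le> \<phi> z"
proof -
  let ?N = "\<gamma> / 2 * (norm (x - z))\<^sup>2"
  let ?E = "\<phi> z - \<phi> x - s \<bullet> (z - x)"
  have "?N \<le> ?E"
  \<comment> \<open>The limit is replaced by an inequality with every factor
    \<open>r = 1 - t\<close> below 1.\<close>
  proof (rule field_le_mult_one_interval)
    fix r :: real assume r: "0 < r" "r < 1"
    define t where "t = 1 - r"
    have t: "0 < t" "t < 1" using r by (auto simp: t_def)
    have "\<phi> x - s \<bullet> x \<le> \<phi> ((1 - t) *\<^sub>R x + t *\<^sub>R z) - s \<bullet> ((1 - t) *\<^sub>R x + t *\<^sub>R z)"
      by (rule min)
    moreover have "\<phi> ((1 - t) *\<^sub>R x + t *\<^sub>R z)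
        \<le> (1 - t) * \<phi> x + t * \<phi> z - \<gamma> / 2 * t * (1 - t) * (norm (x - z))\<^sup>2"
      using sc[unfolded strongly_convex_def, rule_format, of t x z] t by simp
    ultimately have "t * ((1 - t) * ?N) \<le> t * ?E"
      by (simp add: inner_add_right inner_diff_right algebra_simps)
    then show "r * ?N \<le> ?E" using t by (simp add: t_def)
  qed
  then show ?thesis by linarith
qed

text \<open>The segment from 0 to \<open>z\<close> crosses the unit sphere, where the tilted
  function is at least \<open>m\<close>. Strong convexity caps its value at the crossing, and beyond
  the threshold the gain \<open>\<gamma> / 2 * (norm z - 1)\<close> outweighs
  \<open>\<phi> 0 - m\<close>.\<close>

lemma strongly_convex_coercive:
  assumes sc: "strongly_convex \<gamma> \<phi>" "0 < \<gamma>" and m: "\<And>z. norm z = 1 \<Longrightarrow> m \<le> \<phi> z - s \<bullet> z"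
    and z: "norm z > 1" "norm z \<ge> 1 + 2 * (\<phi> 0 - m) / \<gamma>"
  shows "\<phi> 0 \<le> \<phi> z - s \<bullet> z"
proof -
  let ?n = "norm z"
  define t where "t = 1 / ?n"
  have "0 < ?n" using z(1) by linarith
  then have t: "0 < t" "t < 1" "?n * t = 1" using z(1) by (auto simp: t_def field_simps)
  have "\<phi> ((1 - t) *\<^sub>R 0 + t *\<^sub>R z)
      \<le> (1 - t) * \<phi> 0 + t * \<phi> z - \<gamma> / 2 * t * (1 - t) * (norm (0 - z))\<^sup>2"
    using sc(1)[unfolded strongly_convex_def, rule_format, of t 0 z] t(1,2) by simp
  moreover have "m \<le> \<phi> (t *\<^sub>R z) - s \<bullet> (t *\<^sub>R z)" by (rule m) (use t in \<open>simp add: mult.commute[of t]\<close>)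
  ultimately have "m \<le> (1 - t) * \<phi> 0 + t * (\<phi> z - s \<bullet> z) - \<gamma> / 2 * t * (1 - t) * ?n\<^sup>2"
    by (simp add: algebra_simps)
  also have "\<gamma> / 2 * t * (1 - t) * ?n\<^sup>2 = \<gamma> / 2 * (?n - 1)"
  proof -
    have "\<gamma> / 2 * t * (1 - t) * ?n\<^sup>2 = \<gamma> / 2 * (?n * t) * (?n - ?n * t)"
      by (simp add: power2_eq_square algebra_simps)
    then show ?thesis unfolding t(3) by simp
  qed
  finally have "m - \<phi> 0 + \<gamma> / 2 * (?n - 1) \<le> t * (\<phi> z - s \<bullet> z - \<phi> 0)"
    by (simp add: algebra_simps)
  moreover have "0 \<le> m - \<phi> 0 + \<gamma> / 2 * (?n - 1)"
    using z(2) \<open>0 < \<gamma>\<close> by (simp add: field_simps)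
  ultimately have "0 \<le> t * (\<phi> z - s \<bullet> z - \<phi> 0)" by linarith
  then show ?thesis using t by (simp add: zero_le_mult_iff)
qed

lemma strongly_convex_minimizer_exists:
  fixes \<phi> :: "real ^ 'n \<Rightarrow> real"
  assumes sc: "strongly_convex \<gamma> \<phi>" "0 < \<gamma>" and cont: "continuous_on UNIV \<phi>"
  obtains x where "\<And>z. \<phi> x - s \<bullet> x \<le> \<phi> z - s \<bullet> z"
proof -
  let ?h = "\<lambda>z. \<phi> z - s \<bullet> z"
  have h: "continuous_on S ?h" for S
    by (intro continuous_intros continuous_on_subset[OF cont]) auto
  obtain m where m: "\<And>z. norm z = 1 \<Longrightarrow> m \<le> ?h z"
  proof -
    have "bounded (?h ` sphere 0 1)"
      by (intro compact_imp_bounded compact_continuous_image h) auto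
    then obtain B where B: "\<forall>z\<in>sphere 0 1. \<bar>?h z\<bar> \<le> B" by (auto simp: bounded_iff)
    have "- B \<le> ?h z" if "norm z = 1" for z
      using bspec[OF B, of z] that by (simp add: abs_le_iff)
    then show ?thesis by (rule that)
  qed
  define R where "R = max 1 (1 + 2 * (\<phi> 0 - m) / \<gamma>)"
  have "R \<ge> 1" by (simp add: R_def)
  then obtain x where x: "x \<in> cball 0 R" "\<And>z. z \<in> cball 0 R \<Longrightarrow> ?h x \<le> ?h z"
    using continuous_attains_inf[of "cball 0 R" ?h] h by auto
  have "?h x \<le> ?h z" for z
  proof (cases "norm z \<le> R")
    case False
    then have "?h 0 \<le> ?h z"
      using strongly_convex_coercive[OF sc m, where z = z] by (simp add: R_def)
    moreover have "?h x \<le> ?h 0" using \<open>R \<ge> 1\<close> by (intro x) simp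
    ultimately show ?thesis by linarith
  qed (simp add: x)
  then show ?thesis by (rule that)
qed

lemma quadratic_young:
  fixes u v :: "'a::real_inner"
  assumes "0 < \<gamma>"
  shows "u \<bullet> v \<le> \<gamma> / 2 * (norm v)\<^sup>2 + (norm u)\<^sup>2 / (2 * \<gamma>)"
proof -
  have "0 \<le> (norm (u - \<gamma> *\<^sub>R v))\<^sup>2 / (2 * \<gamma>)" using assms by simp
  also have "\<dots> = \<gamma> / 2 * (norm v)\<^sup>2 + (norm u)\<^sup>2 / (2 * \<gamma>) - u \<bullet> v"
    unfolding power2_norm_eq_inner using assms
    by (simp add: inner_diff_left inner_diff_right inner_commute field_simps power2_eq_square)
  finally show ?thesis by linarith
qed

section \<open>The conjugate gradient map and estimates for the Bregman distance\<close>

text \<open>The affine function \<open>s' \<bullet> x - \<phi> x\<close> of \<open>s'\<close>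
  touches the conjugate at \<open>s\<close> from below, and growth at the minimiser with Young's
  inequality bounds the gap by \<open>(norm (s' - s))\<^sup>2 / (2 * \<gamma>)\<close>. The same
  upper bound shows that the real supremum is a genuine one.\<close>

lemma fenchel_conj_gderiv:
  fixes \<phi> :: "real ^ 'n \<Rightarrow> real"
  assumes sc: "strongly_convex \<gamma> \<phi>" "0 < \<gamma>" and min: "\<And>z. \<phi> x - s \<bullet> x \<le> \<phi> z - s \<bullet> z"
  shows "GDERIV (fenchel_conj \<phi>) s :> x"
proof -
  have ub: "s' \<bullet> z - \<phi> z \<le> s \<bullet> x - \<phi> x + (s' - s) \<bullet> x + (norm (s' - s))\<^sup>2 / (2 * \<gamma>)" for s' z
    using strongly_convex_minimizer_growth[OF sc(1) min, of z]
      quadratic_young[OF sc(2), of "s' - s" "z - x"]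
    by (simp add: inner_diff_left inner_diff_right norm_minus_commute)
  have up: "fenchel_conj \<phi> s' \<le> s \<bullet> x - \<phi> x + (s' - s) \<bullet> x + (norm (s' - s))\<^sup>2 / (2 * \<gamma>)" for s'
    unfolding fenchel_conj_def by (rule cSUP_least) (use ub in auto)
  have lo: "s' \<bullet> x - \<phi> x \<le> fenchel_conj \<phi> s'" for s'
    unfolding fenchel_conj_def by (rule cSUP_upper) (use ub[of s'] in \<open>auto intro!: bdd_aboveI2\<close>)
  have eq: "fenchel_conj \<phi> s = s \<bullet> x - \<phi> x" using up[of s] lo[of s] by simp
  have quad: "\<bar>fenchel_conj \<phi> y - fenchel_conj \<phi> s - (y - s) \<bullet> x\<bar> \<le> (norm (y - s))\<^sup>2 / (2 * \<gamma>)" for y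
    using up[of y] lo[of y] \<open>0 < \<gamma>\<close> unfolding eq abs_le_iff
    by (auto simp: inner_diff_left intro: order_trans[of _ 0])
  show ?thesis
    unfolding gderiv_def
  proof (rule has_derivativeI_sandwich[of 1])
    show "bounded_linear (\<lambda>h. h \<bullet> x)" by (rule bounded_linear_inner_left)
    show "norm (fenchel_conj \<phi> y - fenchel_conj \<phi> s - (y - s) \<bullet> x) / norm (y - s)
        \<le> norm (y - s) / (2 * \<gamma>)" if "y \<noteq> s" for y
      using quad[of y] that by (simp add: divide_le_eq power2_eq_square)
    have "((\<lambda>y. norm (y - s) / (2 * \<gamma>)) \<longlongrightarrow> norm (s - s) / (2 * \<gamma>)) (at s)"
      by (intro tendsto_intros) (use \<open>0 < \<gamma>\<close> in auto)
    then show "((\<lambda>y. norm (y - s) / (2 * \<gamma>)) \<longlongrightarrow> 0) (at s)" by simp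
  qed simp
qed

text \<open>This says that \<open>s\<close> is a subgradient of \<open>\<phi>\<close> at
  \<open>x\<close>, the link between dual and primal iterates.\<close>

lemma grad_fenchel_conj_minimizer:
  fixes \<phi> :: "real ^ 'n \<Rightarrow> real"
  assumes sc: "strongly_convex \<gamma> \<phi>" "0 < \<gamma>" and cont: "continuous_on UNIV \<phi>"
    and x: "x = grad (fenchel_conj \<phi>) s"
  shows "\<phi> x - s \<bullet> x \<le> \<phi> z - s \<bullet> z"
proof -
  obtain x' where min: "\<And>z. \<phi> x' - s \<bullet> x' \<le> \<phi> z - s \<bullet> z"
    using strongly_convex_minimizer_exists[OF sc cont, of s] by blast
  have "x = x'" unfolding x by (rule grad_eqI[OF fenchel_conj_gderiv[OF sc min]])
  with min show ?thesis by simp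
qed

lemma bregman_ge:
  fixes \<phi> :: "real ^ 'n \<Rightarrow> real"
  assumes "strongly_convex \<gamma> \<phi>" "0 < \<gamma>" "continuous_on UNIV \<phi>" "x = grad (fenchel_conj \<phi>) s"
  shows "\<gamma> / 2 * (norm (x - y))\<^sup>2 \<le> bregman \<phi> s x y"
  using strongly_convex_minimizer_growth[OF assms(1) grad_fenchel_conj_minimizer[OF assms], of y]
  unfolding bregman_def by linarith

text \<open>Since \<open>x\<close> minimises the tilted function, differentiability forces
  \<open>grad \<phi> x = s\<close>, and the smoothness inequality becomes the claim.\<close>

lemma bregman_le:
  fixes \<phi> :: "real ^ 'n \<Rightarrow> real"
  assumes "strongly_convex \<gamma> \<phi>" "0 < \<gamma>" "smooth M \<phi>" "x = grad (fenchel_conj \<phi>) s"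
    and cont: "continuous_on UNIV \<phi>"
  shows "bregman \<phi> s x y \<le> M / 2 * (norm (x - y))\<^sup>2"
proof -
  have diff: "\<phi> differentiable (at x)" using assms(3) by (simp add: smooth_def)
  then obtain \<phi>' where d: "(\<phi> has_derivative \<phi>') (at x)" by (auto simp: differentiable_def)
  have min: "\<phi> x - s \<bullet> x \<le> \<phi> z - s \<bullet> z" for z
    by (rule grad_fenchel_conj_minimizer) (use assms in auto)
  have "((\<lambda>z. \<phi> z - s \<bullet> z) has_derivative (\<lambda>h. \<phi>' h - s \<bullet> h)) (at x)"
    by (intro has_derivative_diff d has_derivative_inner_right has_derivative_ident)
  then have "(\<lambda>h. \<phi>' h - s \<bullet> h) = (\<lambda>h. 0)"
    by (rule differential_zero_maxmin[of x UNIV, rotated 2]) (use min in auto)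
  then have "\<phi>' = (\<lambda>h. h \<bullet> s)" by (auto simp: fun_eq_iff inner_commute)
  then have "grad \<phi> x = s" using d by (intro grad_eqI) (simp add: gderiv_def)
  then have "\<phi> y \<le> \<phi> x + s \<bullet> (y - x) + M / 2 * (norm (x - y))\<^sup>2"
    using assms(3) by (auto simp: smooth_def)
  then show ?thesis by (simp add: bregman_def)
qed

text \<open>Growth at \<open>x\<close> contributes
  \<open>- \<gamma> / 2 * (norm (x' - x))\<^sup>2\<close>, which absorbs the cross term
  \<open>(s' - s) \<bullet> (x' - x)\<close>. This works for any \<open>x'\<close>, so the new
  primal point need not be known.\<close>

lemma bregman_descent:
  fixes \<phi> :: "real ^ 'n \<Rightarrow> real"
  assumes "strongly_convex \<gamma> \<phi>" "0 < \<gamma>" "continuous_on UNIV \<phi>" "x = grad (fenchel_conj \<phi>) s"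
  shows "bregman \<phi> s' x' y \<le> bregman \<phi> s x y + (s' - s) \<bullet> (x - y) + (norm (s' - s))\<^sup>2 / (2 * \<gamma>)"
  using bregman_ge[OF assms, of x'] quadratic_young[OF assms(2), of "s' - s" "x' - x"]
  unfolding bregman_def norm_minus_commute[of x x'] inner_diff_left inner_diff_right by linarith

text \<open>Compare the lower and upper Bregman bounds at two points at distance 1. It yields
  \<open>0 < M\<close> and is needed for \<open>c \<le> 1\<close>.\<close>

lemma smooth_constant_ge:
  fixes \<phi> :: "real ^ 'n \<Rightarrow> real"
  assumes "strongly_convex \<gamma> \<phi>" "0 < \<gamma>" "smooth M \<phi>"
    and cont: "continuous_on UNIV \<phi>"
  shows "\<gamma> \<le> M"
proof -
  let ?x = "grad (fenchel_conj \<phi>) 0"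
  let ?y = "?x - axis undefined 1"
  have "\<gamma> / 2 * (norm (?x - ?y))\<^sup>2 \<le> M / 2 * (norm (?x - ?y))\<^sup>2"
    using bregman_ge[OF assms(1,2) cont refl] bregman_le[OF assms(1-3) refl cont]
    by (rule order_trans)
  then show ?thesis by simp
qed

lemma smooth_continuous_on:
  assumes "smooth M \<phi>"
  shows "continuous_on S \<phi>"
proof (rule continuous_at_imp_continuous_on, rule ballI)
  fix x
  have "\<phi> differentiable (at x)" using assms by (simp add: smooth_def)
  then show "isCont \<phi> x" by (rule differentiable_imp_continuous_within)
qed

subsection \<open>Independent uniform choices\<close>

text \<open>Splitting off the last choice plays the role of conditioning on the first
  \<open>k\<close> choices.\<close>

lemma sum_PiE_Suc:
  fixes F :: "(nat \<Rightarrow> 'b) \<Rightarrow> real"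
  shows "(\<Sum>B\<in>PiE {..<Suc k} (\<lambda>_. J). F B) = (\<Sum>B\<in>PiE {..<k} (\<lambda>_. J). \<Sum>S\<in>J. F (B(k := S)))"
proof -
  have "(\<Sum>B\<in>PiE {..<Suc k} (\<lambda>_. J). F B) = (\<Sum>(S, B)\<in>J \<times> PiE {..<k} (\<lambda>_. J). F (B(k := S)))"
    unfolding lessThan_Suc PiE_insert_eq
    by (subst sum.reindex) (auto intro!: inj_combinator sum.cong)
  also have "\<dots> = (\<Sum>B\<in>PiE {..<k} (\<lambda>_. J). \<Sum>S\<in>J. F (B(k := S)))"
    by (simp add: sum.cartesian_product[symmetric] sum.swap[of _ _ J])
  finally show ?thesis .
qed

locale uniform_block_choices = prob_space P for P :: "'w measure" +
  fixes J :: "'b set" and \<xi> :: "nat \<Rightarrow> 'w \<Rightarrow> 'b"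
  assumes J: "finite J" "J \<noteq> {}"
    and indep: "indep_vars (\<lambda>_. count_space J) \<xi> UNIV"
    and unif: "\<And>k. distr P (count_space J) (\<xi> k) = uniform_count_measure J"
begin

definition path_event :: "nat \<Rightarrow> (nat \<Rightarrow> 'b) \<Rightarrow> 'w set" where
  "path_event k B = {\<omega> \<in> space P. \<forall>i<k. \<xi> i \<omega> = B i}"

lemma choice_measurable: "\<xi> i \<in> measurable P (count_space J)"
  using indep by (simp add: indep_vars_def2)

lemma path_event_sets [measurable]: "path_event k B \<in> sets P"
proof -
  have *: "\<xi> i -` {B i} \<inter> space P \<in> sets P" for i
  proof (cases "B i \<in> J")
    case True
    then show ?thesis by (intro measurable_sets[OF choice_measurable]) auto
  next
    case False
    then have "\<xi> i -` {B i} \<inter> space P = {}"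
      using measurable_space[OF choice_measurable, of _ i] by auto metis
    then show ?thesis by simp
  qed
  show ?thesis
  \<comment> \<open>An intersection over no index would be \<open>UNIV\<close> instead of
    \<open>space P\<close>.\<close>
  proof (cases "k = 0")
    case True
    then show ?thesis by (simp add: path_event_def)
  next
    case False
    then have "path_event k B = (\<Inter>i\<in>{..<k}. \<xi> i -` {B i} \<inter> space P)"
      by (auto simp: path_event_def)
    then show ?thesis using False * by (auto intro!: sets.finite_INT simp del: INT_simps)
  qed
qed

lemma prob_choice:
  assumes "S \<in> J" shows "prob (\<xi> i -` {S} \<inter> space P) = 1 / real (card J)"
proof -
  have "prob (\<xi> i -` {S} \<inter> space P) = measure (uniform_count_measure J) {S}"
    unfolding unif[of i, symmetric]
    by (subst measure_distr[OF choice_measurable]) (use assms in auto)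
  then show ?thesis using assms J by (simp add: measure_uniform_count_measure)
qed

lemma prob_path_event:
  assumes B: "B \<in> PiE {..<k} (\<lambda>_. J)"
  shows "prob (path_event k B) = 1 / real (card J) ^ k"
proof (cases "k = 0")
  case True
  then show ?thesis by (simp add: path_event_def prob_space)
next
  case False
  have "path_event k B = (\<Inter>i\<in>{..<k}. \<xi> i -` {B i} \<inter> space P)"
    using False by (auto simp: path_event_def)
  also have "prob \<dots> = (\<Prod>i\<in>{..<k}. prob (\<xi> i -` {B i} \<inter> space P))"
  proof (rule indep_setsD)
    show "indep_sets (\<lambda>i. {\<xi> i -` A \<inter> space P |A. A \<in> sets (count_space J)}) UNIV"
      using indep by (simp add: indep_vars_def2)
    show "\<forall>j\<in>{..<k}. \<xi> j -` {B j} \<inter> space P \<in> {\<xi> j -` A \<inter> space P |A. A \<in> sets (count_space J)}"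
      using B by (auto simp: PiE_iff)
  qed (use False in auto)
  also have "\<dots> = (\<Prod>i\<in>{..<k}. 1 / real (card J))"
    by (intro prod.cong refl prob_choice) (use B in \<open>auto simp: PiE_iff\<close>)
  finally show ?thesis by (simp add: power_one_over)
qed

lemma AE_path:
  assumes "AE \<omega> in P. R (\<lambda>i. \<xi> i \<omega>)" and "B \<in> PiE {..<k} (\<lambda>_. J)"
    and dep: "\<And>B B'. (\<And>i. i < k \<Longrightarrow> B i = B' i) \<Longrightarrow> R B = R B'"
  shows "R B"
proof (rule ccontr)
  assume "\<not> R B"
  have "AE \<omega> in P. \<omega> \<notin> path_event k B"
    using assms(1)
  proof eventually_elim
    case (elim \<omega>)
    then show ?case using dep[of "\<lambda>i. \<xi> i \<omega>" B] \<open>\<not> R B\<close> by (auto simp: path_event_def)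
  qed
  then have "prob (path_event k B) = 0" by (subst prob_eq_0) auto
  then show False using prob_path_event[OF assms(2)] J by simp
qed

text \<open>On \<open>space P\<close> the integrand is a finite combination of indicators of the
  disjoint path events, so measurability and integrability come with this representation.\<close>

lemma expectation_paths:
  fixes F :: "(nat \<Rightarrow> 'b) \<Rightarrow> real"
  assumes dep: "\<And>B B'. (\<And>i. i < k \<Longrightarrow> B i = B' i) \<Longrightarrow> F B = F B'"
  shows "expectation (\<lambda>\<omega>. F (\<lambda>i. \<xi> i \<omega>)) = (\<Sum>B\<in>PiE {..<k} (\<lambda>_. J). F B) / real (card J) ^ k"
proof -
  let ?\<Pi> = "PiE {..<k} (\<lambda>_. J)"
  have fin: "finite ?\<Pi>" by (intro finite_PiE J) auto
  have "F (\<lambda>i. \<xi> i \<omega>) = (\<Sum>B\<in>?\<Pi>. F B * indicator (path_event k B) \<omega>)" if \<omega>: "\<omega> \<in> space P" for \<omega>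
  proof -
    \<comment> \<open>Members of the product set are extensional, so the realised sequence must be
      cut off at \<open>k\<close> to be the one path that occurs.\<close>
    define B0 where "B0 = restrict (\<lambda>i. \<xi> i \<omega>) {..<k}"
    have B0: "B0 \<in> ?\<Pi>"
      using measurable_space[OF choice_measurable \<omega>] by (auto simp: B0_def)
    have "\<omega> \<in> path_event k B \<longleftrightarrow> B = B0" if "B \<in> ?\<Pi>" for B
      using that \<omega> PiE_ext[OF that B0] by (force simp: path_event_def B0_def)
    then have "(\<Sum>B\<in>?\<Pi>. F B * indicator (path_event k B) \<omega>) = (\<Sum>B\<in>?\<Pi>. if B = B0 then F B else 0)"
      by (intro sum.cong) (auto simp: indicator_def)
    also have "\<dots> = F B0" using fin B0 by simp
    also have "\<dots> = F (\<lambda>i. \<xi> i \<omega>)" by (rule dep) (simp add: B0_def)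
    finally show ?thesis by simp
  qed
  then have "expectation (\<lambda>\<omega>. F (\<lambda>i. \<xi> i \<omega>))
      = expectation (\<lambda>\<omega>. \<Sum>B\<in>?\<Pi>. F B * indicator (path_event k B) \<omega>)"
    by (intro Bochner_Integration.integral_cong) auto
  also have "\<dots> = (\<Sum>B\<in>?\<Pi>. F B * prob (path_event k B))"
    by (subst Bochner_Integration.integral_sum)
      (auto intro!: integrable_real_mult_indicator sum.cong simp: less_top[symmetric] Int_absorb2 sets.sets_into_space)
  also have "\<dots> = (\<Sum>B\<in>?\<Pi>. F B / real (card J) ^ k)"
    by (intro sum.cong) (auto simp: prob_path_event)
  finally show ?thesis by (simp add: sum_divide_distrib)
qed

end

subsection \<open>One step of the method\<close>

text \<open>The vector companion of \<open>column_block\<close>: the block gradient becomes a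
  projection of the full gradient, and orthogonality of the blocks makes squared norms add
  up.\<close>

definition block_proj :: "'n set \<Rightarrow> real ^ 'n \<Rightarrow> real ^ 'n" where
  "block_proj S v = (\<chi> i. if i \<in> S then v $ i else 0)"

lemma block_proj_idem [simp]: "block_proj S (block_proj S v) = block_proj S v"
  by (simp add: block_proj_def vec_eq_iff)

lemma inner_block_proj: "block_proj S v \<bullet> w = block_proj S v \<bullet> block_proj S w"
  unfolding inner_vec_def block_proj_def by (intro sum.cong) auto

lemma column_block_mult: "column_block S A *v v = A *v block_proj S v"
  unfolding vec_eq_iff matrix_vector_mult_def column_block_def block_proj_def
  by (auto intro!: sum.cong)

lemma transpose_column_block_mult:
  "transpose (column_block S A) *v y = block_proj S (transpose A *v y)"
  by (simp add: vec_eq_iff vector_matrix_mult_def column_block_def block_proj_def)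

lemma sum_block_proj:
  fixes v :: "real ^ 'n"
  assumes "partition_on UNIV \<J>"
  shows "(\<Sum>S\<in>\<J>. block_proj S v) = v"
proof -
  have "(\<Sum>S\<in>\<J>. if i \<in> S then v $ i else 0) = v $ i" for i
  proof -
    obtain S where S: "S \<in> \<J>" "i \<in> S" using partition_onD1[OF assms] by blast
    have "i \<in> T \<longleftrightarrow> T = S" if "T \<in> \<J>" for T
      using partition_onD2[OF assms] that S by (auto dest: disjointD)
    then have "(\<Sum>T\<in>\<J>. if i \<in> T then v $ i else 0) = (\<Sum>T\<in>\<J>. if T = S then v $ i else 0)"
      by (intro sum.cong) auto
    then show ?thesis using S finite[of \<J>] by simp
  qed
  then show ?thesis by (simp add: vec_eq_iff block_proj_def)
qed

lemma sum_inner_block_proj: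
  fixes v :: "real ^ 'n"
  assumes "partition_on UNIV \<J>"
  shows "(\<Sum>S\<in>\<J>. block_proj S v \<bullet> w) = v \<bullet> w"
  by (simp add: inner_sum_left[symmetric] sum_block_proj[OF assms])

lemma sum_norm_block_proj:
  fixes v :: "real ^ 'n"
  assumes "partition_on UNIV \<J>"
  shows "(\<Sum>S\<in>\<J>. (norm (block_proj S v))\<^sup>2) = (norm v)\<^sup>2"
  using sum_inner_block_proj[OF assms, of v v]
  by (simp add: power2_norm_eq_inner inner_block_proj[symmetric])

text \<open>The case distinction of the step disappears because for \<open>g = 0\<close> a multiple
  of the zero vector is subtracted; \<open>g\<close> is already supported on \<open>S\<close>, so
  embedding it changes nothing.\<close>

lemma scbnb_step_eq:
  assumes "x = grad (fenchel_conj \<phi>) s" "g = block_proj S (transpose (Jf x) *v f x)"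
  shows "scbnb_step f Jf \<phi> \<gamma> \<delta> S s = s - (\<delta> * (\<gamma> * (norm g)\<^sup>2 / (norm (Jf x *v g))\<^sup>2)) *\<^sub>R g"
  unfolding scbnb_step_def Let_def transpose_column_block_mult column_block_mult
    assms(1)[symmetric] assms(2)[symmetric]
  by (simp add: assms(2))

lemma scbnb_dual_cong:
  assumes "\<And>i. i < k \<Longrightarrow> B i = B' i"
  shows "scbnb_dual f Jf \<phi> \<gamma> \<delta> xs0 B k = scbnb_dual f Jf \<phi> \<gamma> \<delta> xs0 B' k"
  using assms by (induction k) auto

text \<open>With \<open>G = norm g\<close> and \<open>N = norm (A *v g)\<close> the step size is
  \<open>\<gamma>\<close> over the squared gain of \<open>A\<close> at \<open>g\<close>, and the
  gain lies between \<open>l\<close> and \<open>u\<close>.\<close>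

lemma step_size_bounds:
  fixes l u :: real
  assumes l: "0 < l" and G: "0 < G" "l * G \<le> N" "N \<le> u * G" and \<gamma>: "0 < \<gamma>"
  shows "\<gamma> / u\<^sup>2 \<le> \<gamma> * G\<^sup>2 / N\<^sup>2" "\<gamma> * G\<^sup>2 / N\<^sup>2 \<le> \<gamma> / l\<^sup>2"
proof -
  have N: "0 < N" using l G mult_pos_pos[of l G] by linarith
  then have u: "0 < u" using G by (smt (verit) zero_less_mult_iff)
  have "N\<^sup>2 \<le> u\<^sup>2 * G\<^sup>2" "l\<^sup>2 * G\<^sup>2 \<le> N\<^sup>2"
    using power_mono[OF G(3), of 2] power_mono[OF G(2), of 2] N l G
    by (auto simp: power_mult_distrib)
  then show "\<gamma> / u\<^sup>2 \<le> \<gamma> * G\<^sup>2 / N\<^sup>2" "\<gamma> * G\<^sup>2 / N\<^sup>2 \<le> \<gamma> / l\<^sup>2"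
    using N u l \<gamma> by (auto simp: divide_le_eq le_divide_eq mult_ac)
qed

text \<open>The step size of block \<open>S\<close> lies between \<open>\<delta> \<gamma> / u\<^sup>2\<close> and \<open>\<delta> \<gamma> / l\<^sup>2\<close>. Replacing it by the
  lower bound, which does not depend on \<open>S\<close>, costs the \<open>l\<^sup>-\<^sup>2 - u\<^sup>-\<^sup>2\<close> term.\<close>

lemma bregman_block_step:
  fixes f :: "real ^ 'n \<Rightarrow> real ^ 'm"
  assumes sc: "strongly_convex \<gamma> \<phi>" "0 < \<gamma>" "continuous_on UNIV \<phi>"
    and x: "x = grad (fenchel_conj \<phi>) s"
    and lu: "0 < l" "\<And>v. l * norm v \<le> norm (Jf x *v v)" "\<And>v. norm (Jf x *v v) \<le> u * norm v"
    and "0 < \<delta>"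
    and g: "g = block_proj S (transpose (Jf x) *v f x)"
  shows "bregman \<phi> (scbnb_step f Jf \<phi> \<gamma> \<delta> S s) x' y
    \<le> bregman \<phi> s x y - \<delta> * \<gamma> / u\<^sup>2 * (g \<bullet> (x - y))
      + \<delta> * \<gamma> * (1 / l\<^sup>2 - 1 / u\<^sup>2) / 2 * ((norm g)\<^sup>2 / l\<^sup>2 + l\<^sup>2 * (norm (block_proj S (x - y)))\<^sup>2)
      + \<delta>\<^sup>2 * \<gamma> / (2 * l ^ 4) * (norm g)\<^sup>2"
proof -
  define t where "t = \<gamma> * (norm g)\<^sup>2 / (norm (Jf x *v g))\<^sup>2"
  \<comment> \<open>Pairing \<open>g\<close> with the projected error lets the error terms sum over
    the blocks to the squared norm of \<open>x - y\<close>, not to a multiple of it by the number of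
    blocks.\<close>
  define e where "e = block_proj S (x - y)"
  define p where "p = g \<bullet> e"
  have p: "g \<bullet> (x - y) = p" unfolding p_def e_def g by (rule inner_block_proj)
  have step: "scbnb_step f Jf \<phi> \<gamma> \<delta> S s = s - (\<delta> * t) *\<^sub>R g"
    unfolding t_def by (rule scbnb_step_eq[where f = f and Jf = Jf, OF x g])
  \<comment> \<open>Young's inequality with weight \<open>l\<^sup>2\<close>, for both signs; the
    resulting \<open>l\<^sup>2 * (norm e)\<^sup>2\<close> sums to the quantity that the cone
    condition controls.\<close>
  have "(- g) \<bullet> e \<le> l\<^sup>2 / 2 * (norm e)\<^sup>2 + (norm (- g))\<^sup>2 / (2 * l\<^sup>2)"
    "g \<bullet> e \<le> l\<^sup>2 / 2 * (norm e)\<^sup>2 + (norm g)\<^sup>2 / (2 * l\<^sup>2)"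
    by (rule quadratic_young; use lu(1) in simp)+
  then have abs_p: "\<bar>p\<bar> \<le> ((norm g)\<^sup>2 / l\<^sup>2 + l\<^sup>2 * (norm e)\<^sup>2) / 2"
    by (simp add: p_def abs_le_iff field_simps)
  have tb: "\<gamma> / u\<^sup>2 \<le> t \<and> t \<le> \<gamma> / l\<^sup>2" if "g \<noteq> 0"
    unfolding t_def using step_size_bounds[OF lu(1) _ lu(2,3) sc(2), of g] that by simp
  \<comment> \<open>The sign of \<open>p\<close> is unknown, so lowering the step size costs a
    multiple of \<open>\<bar>p\<bar>\<close>. For \<open>g = 0\<close> division by zero makes
    \<open>t = 0\<close>, outside its bounds, but then \<open>p = 0\<close> too.\<close>
  have lin: "- (t * p) \<le> - (\<gamma> / u\<^sup>2 * p) + (\<gamma> / l\<^sup>2 - \<gamma> / u\<^sup>2) * \<bar>p\<bar>"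
  proof (cases "g = 0")
    case False
    have "(t - \<gamma> / u\<^sup>2) * (- p) \<le> (t - \<gamma> / u\<^sup>2) * \<bar>p\<bar>"
      using tb[OF False] by (intro mult_left_mono) auto
    also have "\<dots> \<le> (\<gamma> / l\<^sup>2 - \<gamma> / u\<^sup>2) * \<bar>p\<bar>"
      using tb[OF False] by (intro mult_right_mono) auto
    finally show ?thesis by (simp add: algebra_simps)
  qed (simp add: p_def)
  have quad: "t\<^sup>2 * (norm g)\<^sup>2 \<le> (\<gamma> / l\<^sup>2)\<^sup>2 * (norm g)\<^sup>2"
  proof (cases "g = 0")
    case False
    have "0 \<le> t" using sc(2) by (simp add: t_def)
    then show ?thesis using tb[OF False] by (intro mult_right_mono power_mono) auto
  qed simp
  have l_le_u: "l \<le> u"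
  proof -
    obtain w :: "real ^ 'n" where "norm w = 1" using unit_vector_exists by blast
    then show ?thesis using lu(2)[of w] lu(3)[of w] by simp
  qed
  have diff: "0 \<le> \<gamma> / l\<^sup>2 - \<gamma> / u\<^sup>2"
    using l_le_u lu(1) sc(2) by (simp add: frac_le power_mono)
  have "bregman \<phi> (scbnb_step f Jf \<phi> \<gamma> \<delta> S s) x' y
      \<le> bregman \<phi> s x y + \<delta> * (- (t * p)) + (\<delta>\<^sup>2 / (2 * \<gamma>)) * (t\<^sup>2 * (norm g)\<^sup>2)"
    using bregman_descent[OF sc x, of "s - (\<delta> * t) *\<^sub>R g" x' y] p
    by (simp add: step power_mult_distrib mult_ac)
  also have "\<dots> \<le> bregman \<phi> s x y
      + \<delta> * (- (\<gamma> / u\<^sup>2 * p) + (\<gamma> / l\<^sup>2 - \<gamma> / u\<^sup>2) * (((norm g)\<^sup>2 / l\<^sup>2 + l\<^sup>2 * (norm e)\<^sup>2) / 2))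
      + (\<delta>\<^sup>2 / (2 * \<gamma>)) * ((\<gamma> / l\<^sup>2)\<^sup>2 * (norm g)\<^sup>2)"
    using \<open>0 < \<delta>\<close> sc(2) diff
    by (intro add_mono order_refl mult_left_mono quad order_trans[OF lin] abs_p) auto
  also have "\<dots> = bregman \<phi> s x y - \<delta> * \<gamma> / u\<^sup>2 * p
      + \<delta> * \<gamma> * (1 / l\<^sup>2 - 1 / u\<^sup>2) / 2 * ((norm g)\<^sup>2 / l\<^sup>2 + l\<^sup>2 * (norm e)\<^sup>2)
      + \<delta>\<^sup>2 * \<gamma> / (2 * l ^ 4) * (norm g)\<^sup>2"
  proof -
    have "(\<delta>\<^sup>2 / (2 * \<gamma>)) * ((\<gamma> / l\<^sup>2)\<^sup>2 * (norm g)\<^sup>2) = \<delta>\<^sup>2 * \<gamma> / (2 * l ^ 4) * (norm g)\<^sup>2"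
      using sc(2) lu(1) by (simp add: field_simps power2_eq_square power4_eq_xxxx)
    moreover have "\<delta> * (- (\<gamma> / u\<^sup>2 * p) + (\<gamma> / l\<^sup>2 - \<gamma> / u\<^sup>2) * (Z / 2))
        = - (\<delta> * \<gamma> / u\<^sup>2 * p) + \<delta> * \<gamma> * (1 / l\<^sup>2 - 1 / u\<^sup>2) / 2 * Z" for Z
    proof -
      have "\<delta> * (- (\<gamma> * B * p) + (\<gamma> * A - \<gamma> * B) * (Z / 2)) = - (\<delta> * \<gamma> * B * p) + \<delta> * \<gamma> * (A - B) / 2 * Z"
        for A B by algebra
      from this[of "1 / u\<^sup>2" "1 / l\<^sup>2"] show ?thesis by simp
    qed
    ultimately show ?thesis by (simp only: diff_conv_add_uminus add.assoc)
  qed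
  finally show ?thesis by (simp add: p e_def)
qed

section \<open>Descent and contraction constants\<close>

text \<open>The summed decrease is at least
  \<open>\<gamma> * \<delta> * descent_rate l u \<eta> \<delta>\<close> times the squared residual.
  Its three terms stem from the cone condition, the variation of the step sizes, and the quadratic
  term of the descent.\<close>

definition descent_rate :: "real \<Rightarrow> real \<Rightarrow> real \<Rightarrow> real \<Rightarrow> real" where
  "descent_rate l u \<eta> \<delta> = (1 - \<eta>) / u\<^sup>2 - (u\<^sup>2 - l\<^sup>2) * (1 + \<eta>)\<^sup>2 / (l ^ 4 * (1 - \<eta>)) - \<delta> * u\<^sup>2 / (2 * l ^ 4)"

text \<open>The rate is \<open>u\<^sup>2 / (2 * l ^ 4)\<close> times the slack in the bound on
  \<open>\<delta>\<close>.\<close>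

lemma descent_rate_nonneg:
  assumes "0 < l" "l \<le> u" "\<eta> < 1"
    and "\<delta> \<le> 2 * (l ^ 4 / u ^ 4 * (1 - \<eta>) - (u\<^sup>2 - l\<^sup>2) * (1 + \<eta>)\<^sup>2 / (u\<^sup>2 * (1 - \<eta>)))"
  shows "0 \<le> descent_rate l u \<eta> \<delta>"
proof -
  have "descent_rate l u \<eta> \<delta> = u\<^sup>2 / (2 * l ^ 4)
      * (2 * (l ^ 4 / u ^ 4 * (1 - \<eta>) - (u\<^sup>2 - l\<^sup>2) * (1 + \<eta>)\<^sup>2 / (u\<^sup>2 * (1 - \<eta>))) - \<delta>)"
    unfolding descent_rate_def using assms(1-3)
    by (simp add: field_simps power2_eq_square power4_eq_xxxx)
  then show ?thesis using assms by simp
qed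

text \<open>Ensures that \<open>1 - c\<close> is nonnegative, so that the recursion can be iterated.
  Dropping the middle term of the rate leaves
  \<open>\<delta> * r - \<delta>\<^sup>2 / (2 * r)\<close> with \<open>r \<le> 1\<close>, which is
  at most \<open>\<delta> - \<delta>\<^sup>2 / 2\<close> and so never exceeds 1.\<close>

lemma contraction_constant_le_1:
  assumes l: "0 < l" "l \<le> u" and \<eta>: "0 < \<eta>" "\<eta> < 1" and \<gamma>: "0 < \<gamma>" "\<gamma> \<le> M" and \<tau>: "1 \<le> \<tau>"
    and "0 < \<delta>" and K: "0 \<le> descent_rate l u \<eta> \<delta>"
  shows "\<gamma> * \<delta> * l\<^sup>2 * descent_rate l u \<eta> \<delta> / (\<tau> * (1 + \<eta>)\<^sup>2 * M) \<le> 1"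
proof -
  define r where "r = l\<^sup>2 / u\<^sup>2"
  have r: "0 < r" "r \<le> 1" using l by (auto simp: r_def power_mono)
  have "descent_rate l u \<eta> \<delta> \<le> 1 / u\<^sup>2 - \<delta> * u\<^sup>2 / (2 * l ^ 4)"
  proof -
    have "(1 - \<eta>) / u\<^sup>2 \<le> 1 / u\<^sup>2" using \<eta> by (intro divide_right_mono) auto
    moreover have "0 \<le> (u\<^sup>2 - l\<^sup>2) * (1 + \<eta>)\<^sup>2 / (l ^ 4 * (1 - \<eta>))"
      using l \<eta> by (intro divide_nonneg_nonneg mult_nonneg_nonneg) (auto simp: power_mono)
    ultimately show ?thesis unfolding descent_rate_def by linarith
  qed
  then have "\<delta> * l\<^sup>2 * descent_rate l u \<eta> \<delta> \<le> \<delta> * l\<^sup>2 * (1 / u\<^sup>2 - \<delta> * u\<^sup>2 / (2 * l ^ 4))"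
    using \<open>0 < \<delta>\<close> by (intro mult_left_mono) auto
  also have "\<dots> = \<delta> * r - \<delta>\<^sup>2 / (2 * r)"
    using l by (simp add: r_def field_simps power2_eq_square power4_eq_xxxx)
  also have "\<dots> \<le> \<delta> - \<delta>\<^sup>2 / 2"
    using r \<open>0 < \<delta>\<close> by (intro diff_mono mult_left_le divide_left_mono) auto
  also have "\<dots> \<le> 1 - (\<delta> - 1)\<^sup>2 / 2"
    by (simp add: power2_eq_square field_simps)
  also have "\<dots> \<le> 1" by simp
  finally have 1: "\<delta> * l\<^sup>2 * descent_rate l u \<eta> \<delta> \<le> 1" .
  have "1 \<le> (1 + \<eta>)\<^sup>2" using \<eta> by (simp add: one_le_power)
  then have "1 \<le> \<tau> * (1 + \<eta>)\<^sup>2" using \<tau> mult_mono[of 1 \<tau> 1 "(1 + \<eta>)\<^sup>2"] by simp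
  then have "1 * M \<le> \<tau> * (1 + \<eta>)\<^sup>2 * M" using \<gamma> by (intro mult_right_mono) auto
  moreover have "\<gamma> * (\<delta> * l\<^sup>2 * descent_rate l u \<eta> \<delta>) \<le> \<gamma> * 1"
    using 1 \<gamma> by (intro mult_left_mono) auto
  moreover have "\<gamma> * \<delta> * l\<^sup>2 * descent_rate l u \<eta> \<delta> = \<gamma> * (\<delta> * l\<^sup>2 * descent_rate l u \<eta> \<delta>)"
    by (simp only: mult.assoc)
  ultimately have "\<gamma> * \<delta> * l\<^sup>2 * descent_rate l u \<eta> \<delta> \<le> \<tau> * (1 + \<eta>)\<^sup>2 * M"
    using \<gamma> by linarith
  moreover have "0 < \<tau> * (1 + \<eta>)\<^sup>2 * M" using \<tau> \<eta> \<gamma> by (intro mult_pos_pos) auto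
  ultimately show ?thesis by (simp add: divide_le_eq)
qed

text \<open>Here \<open>F\<close>, \<open>G\<close>, \<open>E\<close> stand for the squared norms of the residual, of the gradient and of the
  error. The last step keeps only half of the available decrease.\<close>

lemma summed_descent:
  fixes l u :: real
  assumes l: "0 < l" "l \<le> u" and \<eta>: "0 < \<eta>" "\<eta> < 1" and pos: "0 < \<gamma>" "0 < M" "0 < \<tau>" "0 < \<delta>"
    and K: "0 \<le> descent_rate l u \<eta> \<delta>"
    and D: "D \<le> M / 2 * E" and p: "(1 - \<eta>) * F \<le> p" and G: "G \<le> u\<^sup>2 * F"
    and E: "l\<^sup>2 * E \<le> (1 + \<eta>)\<^sup>2 * F" and F: "0 \<le> F"
  shows "\<tau> * D - \<delta> * \<gamma> / u\<^sup>2 * p + \<delta> * \<gamma> * (1 / l\<^sup>2 - 1 / u\<^sup>2) / 2 * (G / l\<^sup>2 + l\<^sup>2 * E)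
      + \<delta>\<^sup>2 * \<gamma> / (2 * l ^ 4) * G
    \<le> \<tau> * (1 - \<gamma> * \<delta> * l\<^sup>2 * descent_rate l u \<eta> \<delta> / (\<tau> * (1 + \<eta>)\<^sup>2 * M)) * D"
proof -
  define K where "K = descent_rate l u \<eta> \<delta>"
  define r where "r = u\<^sup>2 / l\<^sup>2"
  define W where "W = (1 + \<eta>)\<^sup>2 / (1 - \<eta>)"
  have u: "0 < u" using l by linarith
  have r: "1 \<le> r" using l by (simp add: r_def power_mono)
  have W1: "1 \<le> (1 + \<eta>)\<^sup>2" using \<eta> by (simp add: one_le_power)
  have W2: "(1 + \<eta>)\<^sup>2 \<le> W" unfolding W_def using \<eta> W1
    by (simp add: le_divide_eq mult_left_le)
  have d: "0 \<le> 1 / l\<^sup>2 - 1 / u\<^sup>2" using l by (simp add: frac_le power_mono)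
  \<comment> \<open>Both summands are bounded by the product \<open>r * W\<close>; this generous
    estimate gives the middle term of \<open>descent_rate\<close> its form, since \<open>(1 /
    l\<^sup>2 - 1 / u\<^sup>2) * r = (u\<^sup>2 - l\<^sup>2) / l ^ 4\<close>.\<close>
  have "(r + (1 + \<eta>)\<^sup>2) / 2 \<le> r * W"
  proof -
    have "r * 1 \<le> r * W" using r W1 W2 by (intro mult_left_mono) auto
    moreover have "1 * W \<le> r * W" using r W1 W2 by (intro mult_right_mono) auto
    moreover have "(r + V) / 2 \<le> r * W" if "r * 1 \<le> r * W" "1 * W \<le> r * W" "V \<le> W" for V
      using that by simp
    ultimately show ?thesis using W2 by blast
  qed
  then have "(r + (1 + \<eta>)\<^sup>2) / 2 * F \<le> r * W * F" using F by (rule mult_right_mono)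
  moreover have "G / l\<^sup>2 \<le> r * F"
    using divide_right_mono[OF G, of "l\<^sup>2"] by (simp add: r_def)
  ultimately have "(G / l\<^sup>2 + l\<^sup>2 * E) / 2 \<le> r * W * F" using E by (simp add: algebra_simps)
  then have mid: "\<delta> * \<gamma> * (1 / l\<^sup>2 - 1 / u\<^sup>2) * ((G / l\<^sup>2 + l\<^sup>2 * E) / 2)
      \<le> \<delta> * \<gamma> * (1 / l\<^sup>2 - 1 / u\<^sup>2) * (r * W * F)"
    using d pos by (intro mult_left_mono) auto
  have lin: "\<delta> * \<gamma> / u\<^sup>2 * ((1 - \<eta>) * F) \<le> \<delta> * \<gamma> / u\<^sup>2 * p"
    using pos p by (intro mult_left_mono) auto
  have quad: "\<delta>\<^sup>2 * \<gamma> / (2 * l ^ 4) * G \<le> \<delta>\<^sup>2 * \<gamma> / (2 * l ^ 4) * (u\<^sup>2 * F)"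
    using pos l G by (intro mult_left_mono) auto
  have "- (\<delta> * \<gamma> / u\<^sup>2 * ((1 - \<eta>) * F)) + \<delta> * \<gamma> * (1 / l\<^sup>2 - 1 / u\<^sup>2) * (r * W * F)
      + \<delta>\<^sup>2 * \<gamma> / (2 * l ^ 4) * (u\<^sup>2 * F) = - (\<gamma> * \<delta> * K * F)"
  proof -
    have *: "(1 / l\<^sup>2 - 1 / u\<^sup>2) * (r * W) = (u\<^sup>2 - l\<^sup>2) * (1 + \<eta>)\<^sup>2 / (l ^ 4 * (1 - \<eta>))"
      unfolding r_def W_def using l u \<eta>
      by (simp add: field_simps power2_eq_square power4_eq_xxxx)
    show ?thesis unfolding K_def descent_rate_def *[symmetric]
      by (simp add: algebra_simps power2_eq_square)
  qed
  with mid lin quad have "- (\<delta> * \<gamma> / u\<^sup>2 * p)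
      + \<delta> * \<gamma> * (1 / l\<^sup>2 - 1 / u\<^sup>2) / 2 * (G / l\<^sup>2 + l\<^sup>2 * E) + \<delta>\<^sup>2 * \<gamma> / (2 * l ^ 4) * G
      \<le> - (\<gamma> * \<delta> * K * F)"
    unfolding times_divide_eq_right times_divide_eq_left by linarith
  moreover have "\<gamma> * \<delta> * l\<^sup>2 * K / ((1 + \<eta>)\<^sup>2 * M) * D \<le> \<gamma> * \<delta> * K * F"
  proof -
    have "\<gamma> * \<delta> * l\<^sup>2 * K / ((1 + \<eta>)\<^sup>2 * M) * D \<le> \<gamma> * \<delta> * l\<^sup>2 * K / ((1 + \<eta>)\<^sup>2 * M) * (M / 2 * E)"
      using D K pos by (intro mult_left_mono) (auto simp: K_def)
    also have "\<dots> = \<gamma> * \<delta> * K / (2 * (1 + \<eta>)\<^sup>2) * (l\<^sup>2 * E)"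
      using pos by (simp add: field_simps)
    also have "\<dots> \<le> \<gamma> * \<delta> * K / (2 * (1 + \<eta>)\<^sup>2) * ((1 + \<eta>)\<^sup>2 * F)"
      using E K pos by (intro mult_left_mono) (auto simp: K_def)
    also have "\<dots> = \<gamma> * \<delta> * K * F / 2" using \<eta> by (simp add: field_simps)
    also have "\<dots> \<le> \<gamma> * \<delta> * K * F" using K F pos by (simp add: K_def)
    finally show ?thesis .
  qed
  moreover have "\<tau> * (1 - \<gamma> * \<delta> * l\<^sup>2 * K / (\<tau> * (1 + \<eta>)\<^sup>2 * M)) * D
      = \<tau> * D - \<gamma> * \<delta> * l\<^sup>2 * K / ((1 + \<eta>)\<^sup>2 * M) * D"
  proof -
    have "\<tau> * (\<gamma> * \<delta> * l\<^sup>2 * K / (\<tau> * (1 + \<eta>)\<^sup>2 * M)) = \<gamma> * \<delta> * l\<^sup>2 * K / ((1 + \<eta>)\<^sup>2 * M)"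
      using pos by simp
    then show ?thesis by (simp only: right_diff_distrib left_diff_distrib mult_1_right)
  qed
  ultimately show ?thesis unfolding K_def by linarith
qed

text \<open>As \<open>f y = 0\<close>, the condition says that \<open>Jf x *v (x - y)\<close> equals
  \<open>f x\<close> up to an error of norm \<open>\<eta> * norm (f x)\<close>. Cauchy-Schwarz gives
  the first bound, the triangle inequality the second.\<close>

lemma tangential_cone_bounds:
  fixes f :: "real ^ 'n \<Rightarrow> real ^ 'm"
  assumes tcc: "tangential_cone D f Jf \<eta>" and xy: "x \<in> D" "y \<in> D" "f y = 0"
    and l: "0 \<le> l" "\<And>v. l * norm v \<le> norm (Jf x *v v)"
  shows "(1 - \<eta>) * (norm (f x))\<^sup>2 \<le> (transpose (Jf x) *v f x) \<bullet> (x - y)"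
    and "l\<^sup>2 * (norm (x - y))\<^sup>2 \<le> (1 + \<eta>)\<^sup>2 * (norm (f x))\<^sup>2"
proof -
  let ?r = "f x - Jf x *v (x - y)"
  have r: "norm ?r \<le> \<eta> * norm (f x)"
    using tcc xy unfolding tangential_cone_def by (metis diff_zero)
  have "f x \<bullet> ?r \<le> norm (f x) * norm ?r" by (rule norm_cauchy_schwarz)
  also have "\<dots> \<le> norm (f x) * (\<eta> * norm (f x))" by (intro mult_left_mono r) auto
  finally show "(1 - \<eta>) * (norm (f x))\<^sup>2 \<le> (transpose (Jf x) *v f x) \<bullet> (x - y)"
    by (simp add: dot_lmul_matrix inner_diff_right power2_norm_eq_inner[symmetric]
        power2_eq_square algebra_simps)
  have "norm (Jf x *v (x - y)) \<le> norm (f x) + norm ?r"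
    using norm_triangle_ineq4[of "f x" ?r] by simp
  then have "l * norm (x - y) \<le> (1 + \<eta>) * norm (f x)"
    using l(2)[of "x - y"] r by (simp add: algebra_simps)
  then have "(l * norm (x - y))\<^sup>2 \<le> ((1 + \<eta>) * norm (f x))\<^sup>2"
    using l(1) by (intro power_mono) auto
  then show "l\<^sup>2 * (norm (x - y))\<^sup>2 \<le> (1 + \<eta>)\<^sup>2 * (norm (f x))\<^sup>2"
    by (simp add: power_mult_distrib)
qed

text \<open>The gain bound passes to the transpose by writing the squared norm of
  \<open>transpose A *v y\<close> as \<open>y \<bullet> (A *v (transpose A *v y))\<close>.\<close>

lemma norm_transpose_mult_le:
  fixes A :: "real ^ 'n ^ 'm"
  assumes "\<And>v. norm (A *v v) \<le> u * norm v"
  shows "(norm (transpose A *v y))\<^sup>2 \<le> u\<^sup>2 * (norm y)\<^sup>2"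
proof -
  let ?g = "transpose A *v y"
  have "(norm ?g)\<^sup>2 = y \<bullet> (A *v ?g)"
    unfolding power2_norm_eq_inner by (simp add: dot_lmul_matrix)
  also have "\<dots> \<le> norm y * norm (A *v ?g)" by (rule norm_cauchy_schwarz)
  also have "\<dots> \<le> norm y * (u * norm ?g)" by (intro mult_left_mono assms) auto
  finally have "norm ?g * norm ?g \<le> (u * norm y) * norm ?g"
    by (simp add: power2_eq_square mult_ac)
  then have "norm ?g \<le> u * norm y \<or> norm ?g = 0"
    unfolding mult_le_cancel_right using norm_ge_zero[of ?g] by linarith
  then show ?thesis
  proof
    assume "norm ?g \<le> u * norm y"
    then have "(norm ?g)\<^sup>2 \<le> (u * norm y)\<^sup>2" by (intro power_mono) auto
    then show ?thesis by (simp add: power_mult_distrib)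
  qed simp
qed

lemma mean_block_step:
  fixes f :: "real ^ 'n \<Rightarrow> real ^ 'm"
  assumes sc: "strongly_convex \<gamma> \<phi>" "0 < \<gamma>" "continuous_on UNIV \<phi>" and sm: "smooth M \<phi>"
    and x: "x = grad (fenchel_conj \<phi>) s"
    and lu: "0 < l" "l \<le> u" "\<And>v. l * norm v \<le> norm (Jf x *v v)" "\<And>v. norm (Jf x *v v) \<le> u * norm v"
    and \<delta>: "0 < \<delta>" and \<eta>: "0 < \<eta>" "\<eta> < 1"
    and tcc: "tangential_cone D f Jf \<eta>" and xy: "x \<in> D" "y \<in> D" "f y = 0"
    and K: "0 \<le> descent_rate l u \<eta> \<delta>"
    and \<J>: "partition_on UNIV \<J>"
  shows "(\<Sum>S\<in>\<J>. bregman \<phi> (scbnb_step f Jf \<phi> \<gamma> \<delta> S s)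
        (grad (fenchel_conj \<phi>) (scbnb_step f Jf \<phi> \<gamma> \<delta> S s)) y)
    \<le> real (card \<J>) * (1 - \<gamma> * \<delta> * l\<^sup>2 * descent_rate l u \<eta> \<delta> / (real (card \<J>) * (1 + \<eta>)\<^sup>2 * M))
        * bregman \<phi> s x y"
proof -
  let ?g = "transpose (Jf x) *v f x"
  have \<tau>: "0 < real (card \<J>)"
    using partition_onD1[OF \<J>] finite[of \<J>] by (auto simp: card_gt_0_iff)
  have M: "0 < M" using smooth_constant_ge[OF sc(1,2) sm sc(3)] sc(2) by linarith
  have "(\<Sum>S\<in>\<J>. bregman \<phi> (scbnb_step f Jf \<phi> \<gamma> \<delta> S s)
        (grad (fenchel_conj \<phi>) (scbnb_step f Jf \<phi> \<gamma> \<delta> S s)) y)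
      \<le> (\<Sum>S\<in>\<J>. bregman \<phi> s x y - \<delta> * \<gamma> / u\<^sup>2 * (block_proj S ?g \<bullet> (x - y))
      + \<delta> * \<gamma> * (1 / l\<^sup>2 - 1 / u\<^sup>2) / 2
        * ((norm (block_proj S ?g))\<^sup>2 / l\<^sup>2 + l\<^sup>2 * (norm (block_proj S (x - y)))\<^sup>2)
      + \<delta>\<^sup>2 * \<gamma> / (2 * l ^ 4) * (norm (block_proj S ?g))\<^sup>2)"
    by (intro sum_mono bregman_block_step[where f = f and Jf = Jf, OF sc x lu(1,3,4) \<delta> refl])
  also have "\<dots> = real (card \<J>) * bregman \<phi> s x y - \<delta> * \<gamma> / u\<^sup>2 * (?g \<bullet> (x - y))
      + \<delta> * \<gamma> * (1 / l\<^sup>2 - 1 / u\<^sup>2) / 2 * ((norm ?g)\<^sup>2 / l\<^sup>2 + l\<^sup>2 * (norm (x - y))\<^sup>2)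
      + \<delta>\<^sup>2 * \<gamma> / (2 * l ^ 4) * (norm ?g)\<^sup>2"
    unfolding sum.distrib sum_subtractf sum_distrib_left[symmetric] sum_divide_distrib[symmetric]
      sum_inner_block_proj[OF \<J>] sum_norm_block_proj[OF \<J>] sum_constant by simp
  also have "\<dots> \<le> real (card \<J>)
      * (1 - \<gamma> * \<delta> * l\<^sup>2 * descent_rate l u \<eta> \<delta> / (real (card \<J>) * (1 + \<eta>)\<^sup>2 * M)) * bregman \<phi> s x y"
    by (rule summed_descent[OF lu(1,2) \<eta> sc(2) M \<tau> \<delta> K bregman_le[OF sc(1,2) sm x sc(3)]
          tangential_cone_bounds(1)[where f = f and Jf = Jf, OF tcc xy _ lu(3)] norm_transpose_mult_le[where A = "Jf x", OF lu(4)]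
          tangential_cone_bounds(2)[where f = f and Jf = Jf, OF tcc xy _ lu(3)]])
      (use lu(1) in auto)
  finally show ?thesis .
qed

subsection \<open>Convergence\<close>

theorem theorem1:
  fixes D :: "(real ^ 'n) set"
    and f :: "real ^ 'n \<Rightarrow> real ^ 'm"
    and Jf :: "real ^ 'n \<Rightarrow> real ^ 'n ^ 'm"
    and \<phi> :: "real ^ 'n \<Rightarrow> real"
    and xhat xs0 :: "real ^ 'n"
    and \<eta> \<gamma> M \<delta> \<sigma>l \<sigma>u a b Q c :: real
    and \<J> :: "'n set set"
    and \<tau> :: nat
    and P :: "'w measure"
    and \<xi> :: "nat \<Rightarrow> 'w \<Rightarrow> 'n set"
    and Xs X :: "nat \<Rightarrow> 'w \<Rightarrow> real ^ 'n"
  assumes "bounded D" and "closed D"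
    and "\<And>x. x \<in> D \<Longrightarrow> (f has_derivative (\<lambda>h. Jf x *v h)) (at x within D)"
    and "continuous_on D Jf"
    and "0 < \<eta>" and "\<eta> < 1" and "tangential_cone D f Jf \<eta>"
    and "convex_on UNIV \<phi>" and "lower_semicont \<phi>"
    and "0 < \<gamma>" and "strongly_convex \<gamma> \<phi>" and "smooth M \<phi>"
    and "is_arg_min \<phi> (\<lambda>x. x \<in> D \<and> f x = 0) xhat"
    and "rank (Jf xhat) = CARD('n)"
    and "connected D \<or> (\<forall>x\<in>D. rank (Jf x) = CARD('n))"
    and "\<sigma>l = (INF x\<in>D. sigma_min (Jf x))" and "\<sigma>u = (SUP x\<in>D. sigma_max (Jf x))"
    and "a = \<sigma>l ^ 4" and "b = - (\<sigma>u ^ 4) + \<sigma>l\<^sup>2 * \<sigma>u\<^sup>2" and "a + b > 0"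
    and "b \<noteq> 0 \<Longrightarrow> \<eta> < min 1 ((a - b) / (a + b) - 2 * (sqrt \<bar>a * b\<bar> / (a + b)))"
    and "Q = 2 * (\<sigma>l ^ 4 / \<sigma>u ^ 4 * (1 - \<eta>)
                  - (\<sigma>u\<^sup>2 - \<sigma>l\<^sup>2) * (1 + \<eta>)\<^sup>2 / (\<sigma>u\<^sup>2 * (1 - \<eta>)))"
    and "0 < \<delta>" and "\<delta> \<le> min 2 Q"
    and "partition_on UNIV \<J>" and "\<tau> = card \<J>"
    and "prob_space P"
    and "prob_space.indep_vars P (\<lambda>_. count_space \<J>) \<xi> UNIV"
    and "\<And>k. distr P (count_space \<J>) (\<xi> k) = uniform_count_measure \<J>"
    and "\<And>k \<omega>. Xs k \<omega> = scbnb_dual f Jf \<phi> \<gamma> \<delta> xs0 (\<lambda>i. \<xi> i \<omega>) k"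
    and "\<And>k \<omega>. X k \<omega> = grad (fenchel_conj \<phi>) (Xs k \<omega>)"
    and "\<And>k. AE \<omega> in P. X k \<omega> \<in> D"
    and "c = 1 / M *
           ((2 * \<gamma> * \<sigma>l ^ 4 * (1 - \<eta>)\<^sup>2 - 2 * \<gamma> * (\<sigma>u\<^sup>2 - \<sigma>l\<^sup>2) * (1 + \<eta>)\<^sup>2 * \<sigma>u\<^sup>2)
              / (2 * real \<tau> * (1 + \<eta>)\<^sup>2 * \<sigma>u\<^sup>2 * \<sigma>l\<^sup>2 * (1 - \<eta>)) * \<delta>
            - \<gamma> * \<sigma>u ^ 4 * (1 - \<eta>)
              / (2 * real \<tau> * (1 + \<eta>)\<^sup>2 * \<sigma>u\<^sup>2 * \<sigma>l\<^sup>2 * (1 - \<eta>)) * \<delta>\<^sup>2)"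
  shows "(\<forall>k. prob_space.expectation P (\<lambda>\<omega>. bregman \<phi> (Xs (Suc k) \<omega>) (X (Suc k) \<omega>) xhat)
              \<le> (1 - c) ^ Suc k * prob_space.expectation P (\<lambda>\<omega>. bregman \<phi> (Xs 0 \<omega>) (X 0 \<omega>) xhat))
       \<and> (xs0 = 0 \<and> grad (fenchel_conj \<phi>) xs0 = 0 \<and> 0 \<le> \<phi> 0 \<longrightarrow>
            (\<forall>k. prob_space.expectation P (\<lambda>\<omega>. (norm (X k \<omega> - xhat))\<^sup>2)
                   \<le> 2 / \<gamma> * (1 - c) ^ k * \<phi> xhat))"
proof -
  have scx: "strongly_convex \<gamma> \<phi>" and \<gamma>: "0 < \<gamma>" and sm: "smooth M \<phi>" and \<eta>: "0 < \<eta>" "\<eta> < 1"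
    and tcc: "tangential_cone D f Jf \<eta>" and \<delta>: "0 < \<delta>" and \<J>: "partition_on UNIV \<J>"
    and \<tau>: "\<tau> = card \<J>" by fact+
  have cont: "continuous_on UNIV \<phi>" by (rule smooth_continuous_on[OF sm])
  have xh: "xhat \<in> D" "f xhat = 0" using assms(13) by (auto simp: is_arg_min_def)
  \<comment> \<open>With \<open>\<sigma>l = 0\<close> the sum \<open>a + b\<close> would be
    \<open>- (\<sigma>u ^ 4)\<close>.\<close>
  have "\<sigma>l \<noteq> 0"
  proof
    assume "\<sigma>l = 0"
    then have "\<sigma>u ^ 4 < 0" using assms(18-20) by simp
    moreover have "0 \<le> \<sigma>u ^ 4" by (rule zero_le_even_power) simp
    ultimately show False by linarith
  qed
  then have lu: "0 < \<sigma>l" "\<sigma>l \<le> \<sigma>u"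
    "\<And>x v. x \<in> D \<Longrightarrow> \<sigma>l * norm v \<le> norm (Jf x *v v)"
    "\<And>x v. x \<in> D \<Longrightarrow> norm (Jf x *v v) \<le> \<sigma>u * norm v"
    using uniform_singular_value_bounds[OF _ assms(4) tcc \<eta>(2) xh(1) assms(14-16) _ assms(17)]
      assms(1,2) by (auto simp: compact_eq_bounded_closed)
  have "0 < \<sigma>u" using lu by linarith
  have \<J>_fin: "finite \<J>" "\<J> \<noteq> {}" using partition_onD1[OF \<J>] by auto
  then have \<tau>_pos: "1 \<le> real \<tau>" by (simp add: \<tau> Suc_le_eq card_gt_0_iff)
  have \<gamma>M: "\<gamma> \<le> M" by (rule smooth_constant_ge[OF scx \<gamma> sm cont])
  then have M: "0 < M" using \<gamma> by linarith
  have K: "0 \<le> descent_rate \<sigma>l \<sigma>u \<eta> \<delta>"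
    using descent_rate_nonneg[OF lu(1,2) \<eta>(2)] assms(22,24) by simp
  have c: "c = \<gamma> * \<delta> * \<sigma>l\<^sup>2 * descent_rate \<sigma>l \<sigma>u \<eta> \<delta> / (real \<tau> * (1 + \<eta>)\<^sup>2 * M)"
    (is "_ = ?c")
  proof -
    have "1 + \<eta> \<noteq> 0" "1 - \<eta> \<noteq> 0" "real \<tau> \<noteq> 0" using \<eta> \<tau>_pos by auto
    then show ?thesis
      unfolding assms(33) descent_rate_def using lu(1) \<open>0 < \<sigma>u\<close> M
      by (simp add: divide_simps) (simp add: power2_eq_square power4_eq_xxxx algebra_simps)
  qed
  have c1: "0 \<le> 1 - c"
    using contraction_constant_le_1[OF lu(1,2) \<eta> \<gamma> \<gamma>M \<tau>_pos \<delta> K] by (simp add: c)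
  interpret uniform_block_choices P \<J> \<xi>
    using assms(27-29) \<J>_fin by (simp add: uniform_block_choices_def uniform_block_choices_axioms_def)
  define S where "S B k = scbnb_dual f Jf \<phi> \<gamma> \<delta> xs0 B k" for B k
  define Y where "Y B k = grad (fenchel_conj \<phi>) (S B k)" for B k
  define V where "V B k = bregman \<phi> (S B k) (Y B k) xhat" for B k
  let ?\<Pi> = "\<lambda>k. PiE {..<k} (\<lambda>_. \<J>)"
  have S_cong: "S B k = S B' k" if "\<And>i. i < k \<Longrightarrow> B i = B' i" for B B' k
    unfolding S_def using that by (rule scbnb_dual_cong)
  have Xs: "Xs k \<omega> = S (\<lambda>i. \<xi> i \<omega>) k" and X: "X k \<omega> = Y (\<lambda>i. \<xi> i \<omega>) k" for k \<omega>
    by (simp_all add: S_def Y_def assms(30,31))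
  have Y_D: "Y B k \<in> D" if "B \<in> ?\<Pi> k" for B k
  proof (rule AE_path[OF _ that, of "\<lambda>B. Y B k \<in> D"])
    show "AE \<omega> in P. Y (\<lambda>i. \<xi> i \<omega>) k \<in> D" using assms(32)[of k] by (simp add: X)
    show "(Y B k \<in> D) = (Y B' k \<in> D)" if "\<And>i. i < k \<Longrightarrow> B i = B' i" for B B'
      using S_cong[OF that] by (simp add: Y_def)
  qed
  \<comment> \<open>The expected Bregman distance after \<open>k\<close> steps, as an average over
    paths.\<close>
  define T where "T k = (\<Sum>B\<in>?\<Pi> k. V B k) / real (card \<J>) ^ k" for k
  have ET: "expectation (\<lambda>\<omega>. bregman \<phi> (Xs k \<omega>) (X k \<omega>) xhat) = T k" for k
    unfolding T_def Xs X V_def[symmetric]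
    by (rule expectation_paths[of k "\<lambda>B. V B k"]) (unfold V_def Y_def, metis S_cong)
  have T_Suc: "T (Suc k) \<le> (1 - c) * T k" for k
  proof -
    have "(\<Sum>B\<in>?\<Pi> (Suc k). V B (Suc k)) = (\<Sum>B\<in>?\<Pi> k. \<Sum>C\<in>\<J>. V (B(k := C)) (Suc k))"
      by (rule sum_PiE_Suc)
    also have "\<dots> \<le> (\<Sum>B\<in>?\<Pi> k. real (card \<J>) * (1 - c) * V B k)"
    proof (rule sum_mono)
      fix B assume B: "B \<in> ?\<Pi> k"
      have "S (B(k := C)) (Suc k) = scbnb_step f Jf \<phi> \<gamma> \<delta> C (S B k)" for C
        using S_cong[of k "B(k := C)" B] by (simp add: S_def)
      then have "(\<Sum>C\<in>\<J>. V (B(k := C)) (Suc k))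
          = (\<Sum>C\<in>\<J>. bregman \<phi> (scbnb_step f Jf \<phi> \<gamma> \<delta> C (S B k))
              (grad (fenchel_conj \<phi>) (scbnb_step f Jf \<phi> \<gamma> \<delta> C (S B k))) xhat)"
        by (simp add: V_def Y_def)
      also have "\<dots> \<le> real (card \<J>) * (1 - ?c) * V B k"
        unfolding V_def \<tau>
        by (rule mean_block_step[where f = f and Jf = Jf, OF scx \<gamma> cont sm Y_def lu(1,2) lu(3,4)[OF Y_D[OF B]] \<delta> \<eta> tcc
              Y_D[OF B] xh K \<J>])
      finally show "(\<Sum>C\<in>\<J>. V (B(k := C)) (Suc k)) \<le> real (card \<J>) * (1 - c) * V B k"
        by (simp add: c)
    qed
    also have "\<dots> = real (card \<J>) * (1 - c) * (\<Sum>B\<in>?\<Pi> k. V B k)"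
      by (rule sum_distrib_left[symmetric])
    finally have "T (Suc k) \<le> real (card \<J>) * (1 - c) * (\<Sum>B\<in>?\<Pi> k. V B k) / real (card \<J>) ^ Suc k"
      unfolding T_def by (intro divide_right_mono) auto
    also have "\<dots> = (1 - c) * T k" using \<J>_fin by (simp add: T_def)
    finally show ?thesis .
  qed
  have T_le: "T k \<le> (1 - c) ^ k * T 0" for k
  proof (induction k)
    case (Suc k)
    have "T (Suc k) \<le> (1 - c) * T k" by (rule T_Suc)
    also have "\<dots> \<le> (1 - c) * ((1 - c) ^ k * T 0)" using Suc c1 by (rule mult_left_mono)
    finally show ?case by (simp add: mult.assoc)
  qed simp
  have norm_le: "expectation (\<lambda>\<omega>. (norm (X k \<omega> - xhat))\<^sup>2) \<le> 2 / \<gamma> * T k" for k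
  proof -
    have "expectation (\<lambda>\<omega>. (norm (X k \<omega> - xhat))\<^sup>2)
        = (\<Sum>B\<in>?\<Pi> k. (norm (Y B k - xhat))\<^sup>2) / real (card \<J>) ^ k"
      unfolding X by (rule expectation_paths[of k "\<lambda>B. (norm (Y B k - xhat))\<^sup>2"]) (unfold Y_def, metis S_cong)
    also have "\<dots> \<le> (\<Sum>B\<in>?\<Pi> k. 2 / \<gamma> * V B k) / real (card \<J>) ^ k"
    proof (intro divide_right_mono sum_mono)
      fix B
      have "\<gamma> / 2 * (norm (Y B k - xhat))\<^sup>2 \<le> V B k"
        unfolding V_def by (rule bregman_ge[OF scx \<gamma> cont Y_def])
      then show "(norm (Y B k - xhat))\<^sup>2 \<le> 2 / \<gamma> * V B k"
        using \<gamma> by (simp add: field_simps)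
    qed simp
    also have "\<dots> = 2 / \<gamma> * T k" by (simp add: T_def sum_distrib_left)
    finally show ?thesis .
  qed
  \<comment> \<open>There is just one path of length 0, so \<open>T 0\<close> is the Bregman
    distance \<open>\<phi> xhat - \<phi> 0\<close>.\<close>
  have zero: "T 0 \<le> \<phi> xhat" if "xs0 = 0" "grad (fenchel_conj \<phi>) xs0 = 0" "0 \<le> \<phi> 0"
    using that by (simp add: T_def V_def Y_def S_def bregman_def)
  show ?thesis
  proof (intro conjI impI allI)
    fix k
    show "expectation (\<lambda>\<omega>. bregman \<phi> (Xs (Suc k) \<omega>) (X (Suc k) \<omega>) xhat)
        \<le> (1 - c) ^ Suc k * expectation (\<lambda>\<omega>. bregman \<phi> (Xs 0 \<omega>) (X 0 \<omega>) xhat)"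
      unfolding ET by (rule T_le)
  next
    fix k
    assume "xs0 = 0 \<and> grad (fenchel_conj \<phi>) xs0 = 0 \<and> 0 \<le> \<phi> 0"
    then have "T 0 \<le> \<phi> xhat" using zero by blast
    then have "(1 - c) ^ k * T 0 \<le> (1 - c) ^ k * \<phi> xhat" using c1 by (intro mult_left_mono) auto
    with T_le[of k] have "T k \<le> (1 - c) ^ k * \<phi> xhat" by linarith
    then have "2 / \<gamma> * T k \<le> 2 / \<gamma> * ((1 - c) ^ k * \<phi> xhat)"
      using \<gamma> by (intro mult_left_mono) auto
    with norm_le[of k] show "expectation (\<lambda>\<omega>. (norm (X k \<omega> - xhat))\<^sup>2) \<le> 2 / \<gamma> * (1 - c) ^ k * \<phi> xhat"
      by (simp add: mult.assoc)
  qed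
qed

end
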